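(* Fix $k\ge 2$. Over ${\sf RCA}_0$, the following are equivalent: (1) ${\sf WKL}_0$. (2) Let $H$ be a hypergraph with a sequence of finite edges. If every finite partial hypergraph of $H$ has a proper $k$-coloring, then $H$ has a proper $k$-coloring. (3) Statement (2) with "proper" replaced by "conflict-free". (4) Statement (2) with "sequence of edges" replaced by "set of edges". (5) Statement (3) with "sequence of edges" replaced by "set of edges".
   Context: ${\sf RCA}_0$ is the base system of second order arithmetic; ${\sf WKL}_0$ is ${\sf RCA}_0$ plus weak König's lemma (every infinite subtree of $2^{<\mathbb{N}}$ has an infinite path). A hypergraph consists of a vertex set $V\subseteq\mathbb{N}$ and edges which are subsets of $V$ of any cardinality. Finite edges are coded by natural numbers; a hypergraph "with a sequence of finite edges" has its edges given by a sequence of such codes, and one "with a set of edges" by a set of such codes. A partial hypergraph of $H$ consists of a subset $V'$ of the vertices of $H$ and a subset $E'$ of the edges of $H$ such that every $e\in E'$ satisfies $e\subseteq V'$; it is finite if $V'$ and $E'$ are finite. A vertex coloring is a map $\chi:V\to\mathbb{N}$; it is a $k$-coloring if its range is contained in $\{0,\dots,k-1\}$; it is proper if $\chi$ is non-constant on each edge containing more than one vertex; it is conflict-free if every edge $e$ contains a vertex whose color is shared by no other vertex of $e$, i.e. $\forall e\,\exists j\ |\{v\in e:\chi(v)=j\}|=1$. *)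

theory Defs
  imports Main
begin

text \<open>
  Structures for the language of second order arithmetic. The first order part is the whole type
  \<open>'m\<close> and need not be the standard natural numbers; the second order part is an arbitrary
  family \<open>Sets\<close> of subsets of it.
\<close>

record 'm l2_struct =
  zero :: 'm  (\<open>\<zero>\<index>\<close>)
  one :: 'm  (\<open>\<one>\<index>\<close>)
  add :: "'m \<Rightarrow> 'm \<Rightarrow> 'm"  (infixl \<open>\<oplus>\<index>\<close> 65)
  mult :: "'m \<Rightarrow> 'm \<Rightarrow> 'm"  (infixl \<open>\<otimes>\<index>\<close> 70)
  less :: "'m \<Rightarrow> 'm \<Rightarrow> bool"  (infix \<open>\<prec>\<index>\<close> 50)
  Sets :: "'m set set"

datatype trm = NVar nat | Zero | One | Plus trm trm | Times trm trm

primrec trm_vars :: "trm \<Rightarrow> nat set" where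
  "trm_vars (NVar x) = {x}"
| "trm_vars Zero = {}"
| "trm_vars One = {}"
| "trm_vars (Plus s t) = trm_vars s \<union> trm_vars t"
| "trm_vars (Times s t) = trm_vars s \<union> trm_vars t"

text \<open>
  In \<open>Mem t X\<close> the second argument is a set variable; set variables and number variables are
  indexed separately.
\<close>

datatype fm =
    Eq trm trm | Lt trm trm | Mem trm nat
  | Neg fm | Conj fm fm | Disj fm fm | Imp fm fm | Iff fm fm
  | AllN nat fm | ExN nat fm | AllS nat fm | ExS nat fm

inductive Sigma00 :: "fm \<Rightarrow> bool" where
  "Sigma00 (Eq s t)"
| "Sigma00 (Lt s t)"
| "Sigma00 (Mem t X)"
| "Sigma00 \<phi> \<Longrightarrow> Sigma00 (Neg \<phi>)"
| "Sigma00 \<phi> \<Longrightarrow> Sigma00 \<psi> \<Longrightarrow> Sigma00 (Conj \<phi> \<psi>)"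
| "Sigma00 \<phi> \<Longrightarrow> Sigma00 \<psi> \<Longrightarrow> Sigma00 (Disj \<phi> \<psi>)"
| "Sigma00 \<phi> \<Longrightarrow> Sigma00 \<psi> \<Longrightarrow> Sigma00 (Imp \<phi> \<psi>)"
| "Sigma00 \<phi> \<Longrightarrow> Sigma00 \<psi> \<Longrightarrow> Sigma00 (Iff \<phi> \<psi>)"
| "Sigma00 \<phi> \<Longrightarrow> x \<notin> trm_vars t \<Longrightarrow> Sigma00 (AllN x (Imp (Lt (NVar x) t) \<phi>))"
| "Sigma00 \<phi> \<Longrightarrow> x \<notin> trm_vars t \<Longrightarrow> Sigma00 (ExN x (Conj (Lt (NVar x) t) \<phi>))"

definition Sigma01 :: "fm \<Rightarrow> bool" where
  "Sigma01 \<phi> \<longleftrightarrow> (\<exists>x \<theta>. \<phi> = ExN x \<theta> \<and> Sigma00 \<theta>)"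

definition Pi01 :: "fm \<Rightarrow> bool" where
  "Pi01 \<phi> \<longleftrightarrow> (\<exists>x \<theta>. \<phi> = AllN x \<theta> \<and> Sigma00 \<theta>)"

locale l2_structure =
  fixes M :: "'m l2_struct"  (structure)
begin

primrec val :: "(nat \<Rightarrow> 'm) \<Rightarrow> trm \<Rightarrow> 'm" where
  "val a (NVar x) = a x"
| "val a Zero = \<zero>"
| "val a One = \<one>"
| "val a (Plus s t) = val a s \<oplus> val a t"
| "val a (Times s t) = val a s \<otimes> val a t"

primrec sat :: "(nat \<Rightarrow> 'm) \<Rightarrow> (nat \<Rightarrow> 'm set) \<Rightarrow> fm \<Rightarrow> bool" where
  "sat a A (Eq s t) \<longleftrightarrow> val a s = val a t"
| "sat a A (Lt s t) \<longleftrightarrow> val a s \<prec> val a t"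
| "sat a A (Mem t X) \<longleftrightarrow> val a t \<in> A X"
| "sat a A (Neg \<phi>) \<longleftrightarrow> \<not> sat a A \<phi>"
| "sat a A (Conj \<phi> \<psi>) \<longleftrightarrow> sat a A \<phi> \<and> sat a A \<psi>"
| "sat a A (Disj \<phi> \<psi>) \<longleftrightarrow> sat a A \<phi> \<or> sat a A \<psi>"
| "sat a A (Imp \<phi> \<psi>) \<longleftrightarrow> (sat a A \<phi> \<longrightarrow> sat a A \<psi>)"
| "sat a A (Iff \<phi> \<psi>) \<longleftrightarrow> (sat a A \<phi> \<longleftrightarrow> sat a A \<psi>)"
| "sat a A (AllN x \<phi>) \<longleftrightarrow> (\<forall>n. sat (a(x := n)) A \<phi>)"
| "sat a A (ExN x \<phi>) \<longleftrightarrow> (\<exists>n. sat (a(x := n)) A \<phi>)"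
| "sat a A (AllS X \<phi>) \<longleftrightarrow> (\<forall>B\<in>Sets M. sat a (A(X := B)) \<phi>)"
| "sat a A (ExS X \<phi>) \<longleftrightarrow> (\<exists>B\<in>Sets M. sat a (A(X := B)) \<phi>)"

definition basic_axioms :: bool where
  "basic_axioms \<longleftrightarrow>
     (\<forall>n. n \<oplus> \<one> \<noteq> \<zero>) \<and>
     (\<forall>m n. m \<oplus> \<one> = n \<oplus> \<one> \<longrightarrow> m = n) \<and>
     (\<forall>m. m \<oplus> \<zero> = m) \<and>
     (\<forall>m n. m \<oplus> (n \<oplus> \<one>) = (m \<oplus> n) \<oplus> \<one>) \<and>
     (\<forall>m. m \<otimes> \<zero> = \<zero>) \<and>
     (\<forall>m n. m \<otimes> (n \<oplus> \<one>) = (m \<otimes> n) \<oplus> m) \<and>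
     (\<forall>m. \<not> m \<prec> \<zero>) \<and>
     (\<forall>m n. m \<prec> n \<oplus> \<one> \<longleftrightarrow> m \<prec> n \<or> m = n)"

text \<open>
  In the two schemes the assignments \<open>a\<close> and \<open>A\<close> supply the number and set parameters; the
  set parameters are members of the second order part.
\<close>

definition Sigma01_induction :: bool where
  "Sigma01_induction \<longleftrightarrow>
     (\<forall>\<phi> x a A. Sigma01 \<phi> \<and> range A \<subseteq> Sets M \<and>
        sat (a(x := \<zero>)) A \<phi> \<and>
        (\<forall>n. sat (a(x := n)) A \<phi> \<longrightarrow> sat (a(x := n \<oplus> \<one>)) A \<phi>) \<longrightarrow>
        (\<forall>n. sat (a(x := n)) A \<phi>))"

definition Delta01_comprehension :: bool where
  "Delta01_comprehension \<longleftrightarrow>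
     (\<forall>\<phi> \<psi> x a A. Sigma01 \<phi> \<and> Pi01 \<psi> \<and> range A \<subseteq> Sets M \<and>
        (\<forall>n. sat (a(x := n)) A \<phi> \<longleftrightarrow> sat (a(x := n)) A \<psi>) \<longrightarrow>
        (\<exists>X\<in>Sets M. \<forall>n. n \<in> X \<longleftrightarrow> sat (a(x := n)) A \<phi>))"

text \<open>
  The second order part of a structure is nonempty by convention, so that set variables have
  values; without this the schemes above would hold vacuously.
\<close>

definition RCA0 :: bool where
  "RCA0 \<longleftrightarrow> Sets M \<noteq> {} \<and> basic_axioms \<and> Sigma01_induction \<and> Delta01_comprehension"

text \<open>
  Coding inside the structure. All quantifiers range over \<open>'m\<close> or over \<open>Sets M\<close>; an
  argument of type \<open>'m set\<close> that is not required to be in \<open>Sets M\<close> is only a definable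
  class, such as the range of a sequence. The pairing function is $(i+j)^2+i$.
\<close>

definition pr :: "'m \<Rightarrow> 'm \<Rightarrow> 'm"  (\<open>\<langle>_,/ _\<rangle>\<close>) where
  "\<langle>i, j\<rangle> = (i \<oplus> j) \<otimes> (i \<oplus> j) \<oplus> i"

primrec num :: "nat \<Rightarrow> 'm" where
  "num 0 = \<zero>"
| "num (Suc n) = num n \<oplus> \<one>"

definition is_finite :: "'m set \<Rightarrow> bool" where
  "is_finite X \<longleftrightarrow> (\<exists>k. \<forall>i\<in>X. i \<prec> k)"

text \<open>
  The triple of $k$, $m$, $n$ determines the finite set of those $i < k$ for which $m(i+1)+1$
  divides $n$. The code of a finite set is the least triple determining it.
\<close>

definition is_triple :: "'m \<Rightarrow> bool" where
  "is_triple c \<longleftrightarrow> (\<exists>k m n. c = \<langle>k, \<langle>m, n\<rangle>\<rangle>)"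

definition elts :: "'m \<Rightarrow> 'm set" where
  "elts c = {i. \<exists>k m n. c = \<langle>k, \<langle>m, n\<rangle>\<rangle> \<and> i \<prec> k \<and> (\<exists>q. n = (m \<otimes> (i \<oplus> \<one>) \<oplus> \<one>) \<otimes> q)}"

definition is_code :: "'m \<Rightarrow> bool" where
  "is_code c \<longleftrightarrow> is_triple c \<and> (\<forall>d. is_triple d \<and> elts d = elts c \<longrightarrow> \<not> d \<prec> c)"

definition is_function :: "'m set \<Rightarrow> 'm set \<Rightarrow> 'm set \<Rightarrow> bool" where
  "is_function f X Y \<longleftrightarrow>
     (\<forall>p\<in>f. \<exists>x\<in>X. \<exists>y\<in>Y. p = \<langle>x, y\<rangle>) \<and> (\<forall>x\<in>X. \<exists>!y. \<langle>x, y\<rangle> \<in> f)"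

definition bin_seq :: "'m \<Rightarrow> 'm \<Rightarrow> bool" where
  "bin_seq s l \<longleftrightarrow> is_code s \<and> is_function (elts s) {i. i \<prec> l} {\<zero>, \<one>}"

definition is_bin_tree :: "'m set \<Rightarrow> bool" where
  "is_bin_tree T \<longleftrightarrow>
     (\<forall>s\<in>T. \<exists>l. bin_seq s l) \<and>
     (\<forall>s\<in>T. \<forall>t l. bin_seq t l \<and> elts t \<subseteq> elts s \<longrightarrow> t \<in> T)"

text \<open>
  Binary sequences are finite functions on initial segments, so that inclusion of their graphs is
  the initial segment relation; similarly for the initial segments of a path.
\<close>

definition is_path :: "'m set \<Rightarrow> 'm set \<Rightarrow> bool" where
  "is_path f T \<longleftrightarrow>
     is_function f UNIV {\<zero>, \<one>} \<and> (\<forall>l. \<exists>s\<in>T. bin_seq s l \<and> elts s \<subseteq> f)"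

definition WKL :: bool where
  "WKL \<longleftrightarrow> (\<forall>T\<in>Sets M. is_bin_tree T \<and> \<not> is_finite T \<longrightarrow> (\<exists>f\<in>Sets M. is_path f T))"

definition WKL0 :: bool where
  "WKL0 \<longleftrightarrow> RCA0 \<and> WKL"

text \<open>
  A hypergraph with vertex set \<open>V\<close> and finite edges, where \<open>E\<close> is the class of codes of
  the edges.
\<close>

definition is_hypergraph :: "'m set \<Rightarrow> 'm set \<Rightarrow> bool" where
  "is_hypergraph V E \<longleftrightarrow> (\<forall>e\<in>E. is_code e \<and> elts e \<subseteq> V)"

definition finite_partial_hypergraph :: "'m set \<Rightarrow> 'm set \<Rightarrow> 'm set \<Rightarrow> 'm set \<Rightarrow> bool" where
  "finite_partial_hypergraph V' E' V E \<longleftrightarrow>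
     V' \<subseteq> V \<and> E' \<subseteq> E \<and> (\<forall>e\<in>E'. elts e \<subseteq> V') \<and> is_finite V' \<and> is_finite E'"

definition is_coloring :: "nat \<Rightarrow> 'm set \<Rightarrow> 'm set \<Rightarrow> bool" where
  "is_coloring k V \<chi> \<longleftrightarrow> is_function \<chi> V {j. j \<prec> num k}"

definition proper :: "'m set \<Rightarrow> 'm set \<Rightarrow> bool" where
  "proper E \<chi> \<longleftrightarrow>
     (\<forall>e\<in>E. (\<exists>u\<in>elts e. \<exists>v\<in>elts e. u \<noteq> v) \<longrightarrow>
        \<not> (\<exists>j. \<forall>v\<in>elts e. \<langle>v, j\<rangle> \<in> \<chi>))"

definition conflict_free :: "'m set \<Rightarrow> 'm set \<Rightarrow> bool" where
  "conflict_free E \<chi> \<longleftrightarrow> (\<forall>e\<in>E. \<exists>j. \<exists>!v. v \<in> elts e \<and> \<langle>v, j\<rangle> \<in> \<chi>)"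

text \<open>Below, \<open>Q\<close> is either \<^const>\<open>proper\<close> or \<^const>\<open>conflict_free\<close>.\<close>

definition has_coloring :: "('m set \<Rightarrow> 'm set \<Rightarrow> bool) \<Rightarrow> nat \<Rightarrow> 'm set \<Rightarrow> 'm set \<Rightarrow> bool" where
  "has_coloring Q k V E \<longleftrightarrow> (\<exists>\<chi>\<in>Sets M. is_coloring k V \<chi> \<and> Q E \<chi>)"

definition finitely_colorable :: "('m set \<Rightarrow> 'm set \<Rightarrow> bool) \<Rightarrow> nat \<Rightarrow> 'm set \<Rightarrow> 'm set \<Rightarrow> bool" where
  "finitely_colorable Q k V E \<longleftrightarrow>
     (\<forall>V'\<in>Sets M. \<forall>E'\<in>Sets M. finite_partial_hypergraph V' E' V E \<longrightarrow> has_coloring Q k V' E')"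

definition seq_range :: "'m set \<Rightarrow> 'm set" where
  "seq_range f = {e. \<exists>i. \<langle>i, e\<rangle> \<in> f}"

definition compactness_edge_seq :: "('m set \<Rightarrow> 'm set \<Rightarrow> bool) \<Rightarrow> nat \<Rightarrow> bool" where
  "compactness_edge_seq Q k \<longleftrightarrow>
     (\<forall>V\<in>Sets M. \<forall>f\<in>Sets M.
        is_function f UNIV UNIV \<and> is_hypergraph V (seq_range f) \<and>
        finitely_colorable Q k V (seq_range f) \<longrightarrow>
        has_coloring Q k V (seq_range f))"

definition compactness_edge_set :: "('m set \<Rightarrow> 'm set \<Rightarrow> bool) \<Rightarrow> nat \<Rightarrow> bool" where
  "compactness_edge_set Q k \<longleftrightarrow>
     (\<forall>V\<in>Sets M. \<forall>E\<in>Sets M.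
        is_hypergraph V E \<and> finitely_colorable Q k V E \<longrightarrow> has_coloring Q k V E)"

end

end

theory Submission imports Defs begin

text \<open>
  From weak Koenig's lemma to colorings: a set \<open>\<chi>\<close> of pairs $(v,j)$ is identified with a binary
  sequence whose bit at the position $(v,j)$ tells whether \<open>v\<close> has color \<open>j\<close>. The sequences of length \<open>l\<close>
  that violate no condition decided below \<open>l\<close> form a tree, which is infinite since every finite
  partial hypergraph is colorable, and a path through it is a coloring.

  Conversely, let \<open>T\<close> be an infinite binary tree. Take vertices $p_s$, $n_s$ for the finite sequences
  $s$, a vertex $x_i$ for every bit $i$ of the path that is sought, and $c_0,\dots,c_{k-1}$. The $c_j$
  form a clique, and the other vertices are joined to $c_2,\dots,c_{k-1}$, so that they take the color of $c_0$
  (false) or of $c_1$ (true). Edges with two or three vertices express that $n_s$ is the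
  negation of $p_s$, that $p_s$ implies $p_{s0}$ or $p_{s1}$, that $p_s$ is false for \<open>s \<notin> T\<close>, that
  $p_s$ is true for the empty \<open>s\<close>,
    and that the last bit $b$ of \<open>s\<close>, at position \<open>l\<close>, agrees with
  $x_l$ whenever $p_s$ is true. By induction on \<open>l\<close>, in every coloring the first \<open>l\<close> bits
  given by the $x_i$ form a sequence \<open>s\<close> with $p_s$ true, hence an element of \<open>T\<close>. A finite part of this hypergraph
  is colored by means of one long element of \<open>T\<close>. As proper and conflict-free mean the same
  for edges with at most three vertices, the argument applies to both.
\<close>

section \<open>Definability with parameters and ordered semiring arithmetic\<close>

primrec ren_trm :: "(nat \<Rightarrow> nat) \<Rightarrow> trm \<Rightarrow> trm" where
  "ren_trm r (NVar x) = NVar (r x)"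
| "ren_trm r Zero = Zero"
| "ren_trm r One = One"
| "ren_trm r (Plus s t) = Plus (ren_trm r s) (ren_trm r t)"
| "ren_trm r (Times s t) = Times (ren_trm r s) (ren_trm r t)"

primrec ren_fm :: "(nat \<Rightarrow> nat) \<Rightarrow> (nat \<Rightarrow> nat) \<Rightarrow> fm \<Rightarrow> fm" where
  "ren_fm r q (Eq s t) = Eq (ren_trm r s) (ren_trm r t)"
| "ren_fm r q (Lt s t) = Lt (ren_trm r s) (ren_trm r t)"
| "ren_fm r q (Mem t X) = Mem (ren_trm r t) (q X)"
| "ren_fm r q (Neg \<phi>) = Neg (ren_fm r q \<phi>)"
| "ren_fm r q (Conj \<phi> \<psi>) = Conj (ren_fm r q \<phi>) (ren_fm r q \<psi>)"
| "ren_fm r q (Disj \<phi> \<psi>) = Disj (ren_fm r q \<phi>) (ren_fm r q \<psi>)"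
| "ren_fm r q (Imp \<phi> \<psi>) = Imp (ren_fm r q \<phi>) (ren_fm r q \<psi>)"
| "ren_fm r q (Iff \<phi> \<psi>) = Iff (ren_fm r q \<phi>) (ren_fm r q \<psi>)"
| "ren_fm r q (AllN x \<phi>) = AllN (r x) (ren_fm r q \<phi>)"
| "ren_fm r q (ExN x \<phi>) = ExN (r x) (ren_fm r q \<phi>)"
| "ren_fm r q (AllS X \<phi>) = AllS (q X) (ren_fm r q \<phi>)"
| "ren_fm r q (ExS X \<phi>) = ExS (q X) (ren_fm r q \<phi>)"

lemma trm_vars_ren: "trm_vars (ren_trm r t) = r ` trm_vars t"
  by (induction t) auto

lemma Sigma00_ren: "Sigma00 \<phi> \<Longrightarrow> inj r \<Longrightarrow> Sigma00 (ren_fm r q \<phi>)"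
  by (induction rule: Sigma00.induct)
    (auto intro!: Sigma00.intros simp: trm_vars_ren inj_image_mem_iff)

primrec zero_var :: "nat \<Rightarrow> trm \<Rightarrow> trm" where
  "zero_var x (NVar y) = (if x = y then Zero else NVar y)"
| "zero_var x Zero = Zero"
| "zero_var x One = One"
| "zero_var x (Plus s t) = Plus (zero_var x s) (zero_var x t)"
| "zero_var x (Times s t) = Times (zero_var x s) (zero_var x t)"

lemma zero_var_fresh: "x \<notin> trm_vars (zero_var x t)"
  by (induction t) auto

text \<open>Even indices hold the variables, odd indices the parameters; \<open>left_var\<close> and \<open>right_var\<close> put
  the parameters of two formulas side by side.\<close>

definition merge :: "(nat \<Rightarrow> 'a) \<Rightarrow> (nat \<Rightarrow> 'a) \<Rightarrow> nat \<Rightarrow> 'a" where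
  "merge a b i = (if even i then a (i div 2) else b (i div 2))"

lemma merge_simps [simp]: "merge a b 0 = a 0" "merge a b (2 * i) = a i" "merge a b (Suc (2 * i)) = b i"
  by (auto simp: merge_def)

lemma merge_upd: "(merge a b)(2 * n := y) = merge (a(n := y)) b"
  by (auto simp: merge_def fun_eq_iff)

lemma range_merge: "range A \<subseteq> S \<Longrightarrow> range B \<subseteq> S \<Longrightarrow>
    range (merge A B) \<subseteq> S"
  by (auto simp: merge_def)

definition left_var :: "nat \<Rightarrow> nat" where "left_var i = (if even i then i else 2 * i - 1)"
definition right_var :: "nat \<Rightarrow> nat" where "right_var i = (if even i then i else 2 * i + 1)"

lemma inj_left_var: "inj left_var"
  unfolding inj_def left_var_def
  by (intro allI, rename_tac x y, case_tac "even x"; case_tac "even y") (auto elim!: oddE)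

lemma inj_right_var: "inj right_var"
  unfolding inj_def right_var_def
  by (intro allI, rename_tac x y, case_tac "even x"; case_tac "even y") auto

lemma merge_left_var: "merge a (merge b c) \<circ> left_var = merge a b"
proof
  show "(merge a (merge b c) \<circ> left_var) i = merge a b i" for i
  proof (cases "even i")
    case False
    then obtain j where "i = Suc (2 * j)" by (auto elim: oddE)
    moreover from this have "left_var i = Suc (2 * (2 * j))" by (simp add: left_var_def)
    ultimately show ?thesis by (simp only: comp_def merge_simps)
  qed (auto simp: merge_def left_var_def)
qed

lemma merge_right_var: "merge a (merge b c) \<circ> right_var = merge a c"
proof
  show "(merge a (merge b c) \<circ> right_var) i = merge a c i" for i
    by (cases "even i") (auto simp: merge_def right_var_def elim!: oddE)
qed

context l2_structure
begin

lemma val_ren: "val a (ren_trm r t) = val (a \<circ> r) t"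
  by (induction t) auto

lemma upd_comp_inj: "inj r \<Longrightarrow> a(r x := n) \<circ> r = (a \<circ> r)(x := n)"
  by (auto simp: fun_eq_iff inj_eq)

lemma sat_ren: "Sigma00 \<phi> \<Longrightarrow> inj r \<Longrightarrow>
    sat a A (ren_fm r q \<phi>) = sat (a \<circ> r) (A \<circ> q) \<phi>"
  by (induction arbitrary: a rule: Sigma00.induct) (simp_all add: val_ren upd_comp_inj)

lemma val_zero_var: "val a (zero_var x t) = val (a(x := \<zero>)) t"
  by (induction t) auto

text \<open>In \<open>definable n R\<close> the number \<open>n\<close> has no meaning: it only makes the introduction rules for bounded
  quantifiers pick a variable not yet in use. Parameters from \<open>M\<close> are arbitrary
    and occur as constants.\<close>

definition is_term :: "((nat \<Rightarrow> 'm) \<Rightarrow> 'm) \<Rightarrow> bool" where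
  "is_term f \<longleftrightarrow> (\<exists>t b. \<forall>a. f a = val (merge a b) t)"

definition definable :: "nat \<Rightarrow> ((nat \<Rightarrow> 'm) \<Rightarrow> bool) \<Rightarrow> bool" where
  "definable n R \<longleftrightarrow> (\<exists>\<phi> A b. Sigma00 \<phi> \<and>
      range A \<subseteq> Sets M \<and> (\<forall>a. R a \<longleftrightarrow> sat (merge a b) A \<phi>))"

lemma is_term_var: "is_term (\<lambda>a. a i)"
  unfolding is_term_def by (rule exI[of _ "NVar (2 * i)"]) simp

lemma is_term_const: "is_term (\<lambda>a. c)"
  unfolding is_term_def by (rule exI[of _ "NVar (Suc (2 * 0))"], rule exI[of _ "\<lambda>_. c"]) (simp add: merge_def)

lemma is_term_common:
  assumes "is_term f" "is_term g"
  obtains s t b where "\<And>a. f a = val (merge a b) s" "\<And>a. g a = val (merge a b) t"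
proof -
  from assms obtain s t b c where st: "\<And>a. f a = val (merge a b) s" "\<And>a. g a = val (merge a c) t"
    unfolding is_term_def by metis
  show ?thesis
    by (rule that[of "merge b c" "ren_trm left_var s" "ren_trm right_var t"])
      (simp_all add: val_ren merge_left_var merge_right_var st)
qed

lemma is_term_add:
  assumes "is_term f" "is_term g"
  shows "is_term (\<lambda>a. f a \<oplus> g a)"
proof -
  obtain s t b where "\<And>a. f a = val (merge a b) s" "\<And>a. g a = val (merge a b) t"
    using is_term_common[OF assms] by metis
  then have "f a \<oplus> g a = val (merge a b) (Plus s t)" for a by simp
  then show ?thesis unfolding is_term_def by blast
qed

lemma is_term_mult:
  assumes "is_term f" "is_term g"
  shows "is_term (\<lambda>a. f a \<otimes> g a)"
proof -
  obtain s t b where "\<And>a. f a = val (merge a b) s" "\<And>a. g a = val (merge a b) t"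
    using is_term_common[OF assms] by metis
  then have "f a \<otimes> g a = val (merge a b) (Times s t)" for a by simp
  then show ?thesis unfolding is_term_def by blast
qed

lemma is_term_pr: "is_term f \<Longrightarrow> is_term g \<Longrightarrow>
    is_term (\<lambda>a. \<langle>f a, g a\<rangle>)"
  unfolding pr_def by (intro is_term_add is_term_mult)

lemmas is_term_intros = is_term_var is_term_add is_term_mult is_term_pr is_term_const

lemma definableI: "Sigma00 \<phi> \<Longrightarrow> range A \<subseteq> Sets M \<Longrightarrow>
    (\<And>a. R a \<longleftrightarrow> sat (merge a b) A \<phi>) \<Longrightarrow> definable n R"
  unfolding definable_def by blast

lemma definable_common:
  assumes "definable m R" "definable n S"
  obtains \<phi> \<psi> A b where "Sigma00 \<phi>" "Sigma00 \<psi>" "range A \<subseteq> Sets M"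
    "\<And>a. R a \<longleftrightarrow> sat (merge a b) A \<phi>" "\<And>a. S a \<longleftrightarrow>
        sat (merge a b) A \<psi>"
proof -
  from assms obtain \<phi> \<psi> A B b c
    where *: "Sigma00 \<phi>" "Sigma00 \<psi>" "range A \<subseteq> Sets M" "range B \<subseteq> Sets M"
    "\<And>a. R a \<longleftrightarrow> sat (merge a b) A \<phi>" "\<And>a. S a \<longleftrightarrow>
        sat (merge a c) B \<psi>"
    unfolding definable_def by metis
  have "merge A B \<circ> (\<lambda>i. 2 * i) = A" "merge A B \<circ> (\<lambda>i. Suc (2 * i)) = B"
    by (auto simp: fun_eq_iff)
  then show ?thesis using *
    by (intro that[of "ren_fm left_var (\<lambda>i. 2 * i) \<phi>" "ren_fm right_var (\<lambda>i. Suc (2 * i)) \<psi>"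
          "merge A B" "merge b c"])
      (simp_all add: Sigma00_ren inj_left_var inj_right_var range_merge sat_ren merge_left_var merge_right_var)
qed

lemma definable_is_term:
  assumes "definable m R" "is_term f"
  obtains \<phi> t A b where "Sigma00 \<phi>" "range A \<subseteq> Sets M"
    "\<And>a. R a \<longleftrightarrow> sat (merge a b) A \<phi>" "\<And>a. f a = val (merge a b) t"
proof -
  from assms obtain \<phi> A b c t where *: "Sigma00 \<phi>" "range A \<subseteq> Sets M"
    "\<And>a. R a \<longleftrightarrow> sat (merge a b) A \<phi>" "\<And>a. f a = val (merge a c) t"
    unfolding definable_def is_term_def by metis
  then show ?thesis
    by (intro that[of "ren_fm left_var (\<lambda>i. i) \<phi>" A "merge b c" "ren_trm right_var t"])
      (simp_all add: Sigma00_ren inj_left_var sat_ren val_ren merge_left_var merge_right_var comp_def[of A])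
qed

lemma definable_not: "definable n R \<Longrightarrow> definable n (\<lambda>a. \<not> R a)"
  by (metis definable_def sat.simps(4) Sigma00.intros(4))

lemma definable_and: "definable n R \<Longrightarrow> definable n S \<Longrightarrow>
    definable n (\<lambda>a. R a \<and> S a)"
  by (erule (1) definable_common) (rule definableI[of "Conj _ _"], simp_all add: Sigma00.intros)

lemma definable_or: "definable n R \<Longrightarrow> definable n S \<Longrightarrow>
    definable n (\<lambda>a. R a \<or> S a)"
  by (erule (1) definable_common) (rule definableI[of "Disj _ _"], simp_all add: Sigma00.intros)

lemma definable_imp: "definable n R \<Longrightarrow> definable n S \<Longrightarrow>
    definable n (\<lambda>a. R a \<longrightarrow> S a)"
  by (erule (1) definable_common) (rule definableI[of "Imp _ _"], simp_all add: Sigma00.intros)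

lemma definable_iff: "definable n R \<Longrightarrow> definable n S \<Longrightarrow>
    definable n (\<lambda>a. R a \<longleftrightarrow> S a)"
  by (erule (1) definable_common) (rule definableI[of "Iff _ _"], simp_all add: Sigma00.intros)

lemma definable_ex:
  assumes "definable (Suc n) (\<lambda>a. R a (a n))" "is_term f"
    and fresh: "\<And>a z y. R (a(n := z)) y = R a y" "\<And>a z. f (a(n := z)) = f a"
  shows "definable n (\<lambda>a. \<exists>x. x \<prec> f a \<and> R a x)"
proof -
  from definable_is_term[OF assms(1,2)] obtain \<phi> t A b where *: "Sigma00 \<phi>" "range A \<subseteq> Sets M"
    "\<And>a. R a (a n) \<longleftrightarrow> sat (merge a b) A \<phi>" "\<And>a. f a = val (merge a b) t" by metis
  have R: "R a y \<longleftrightarrow> sat (merge (a(n := y)) b) A \<phi>" for a y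
    using fresh(1)[of a y y] *(3)[of "a(n := y)"] by simp
  have f: "val (merge a b) (zero_var (2 * n) t) = f a" for a
    by (simp add: val_zero_var merge_upd *(4)[symmetric] fresh)
  show ?thesis
    by (rule definableI[of "ExN (2 * n) (Conj (Lt (NVar (2 * n)) (zero_var (2 * n) t)) \<phi>)" A _ b])
      (use *(1,2) in \<open>simp_all add: Sigma00.intros zero_var_fresh merge_upd f R fresh\<close>)
qed

lemma definable_all:
  assumes "definable (Suc n) (\<lambda>a. R a (a n))" "is_term f"
    and fresh: "\<And>a z y. R (a(n := z)) y = R a y" "\<And>a z. f (a(n := z)) = f a"
  shows "definable n (\<lambda>a. \<forall>x. x \<prec> f a \<longrightarrow> R a x)"
  using definable_not[OF definable_ex[of n "\<lambda>a x. \<not> R a x" f]] definable_not[OF assms(1)] assms(2) fresh by simp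

end

locale rca0 = l2_structure M for M :: "'m l2_struct" (structure) +
  assumes RCA0: "RCA0"
begin

lemma basic: "n \<oplus> \<one> \<noteq> \<zero>" "m \<oplus> \<one> = n \<oplus> \<one> \<Longrightarrow>
    m = n" "m \<oplus> \<zero> = m"
    "m \<oplus> (n \<oplus> \<one>) = (m \<oplus> n) \<oplus> \<one>" "m \<otimes> \<zero> = \<zero>" "m \<otimes> (n \<oplus> \<one>) = (m \<otimes> n) \<oplus> m"
    "\<not> m \<prec> \<zero>" "m \<prec> n \<oplus> \<one> \<longleftrightarrow> m \<prec> n \<or> m = n"
  using RCA0 unfolding RCA0_def basic_axioms_def by blast+

lemmas basic_simps = basic(1,3-8)

lemma ex_assignment: "\<exists>A :: nat \<Rightarrow> 'm set. range A \<subseteq> Sets M"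
proof -
  obtain X where "X \<in> Sets M" using RCA0 unfolding RCA0_def by blast
  then show ?thesis by (intro exI[of _ "\<lambda>_. X"]) auto
qed

lemma definable_eq: 
  assumes "is_term f" "is_term g"
  shows "definable n (\<lambda>a. f a = g a)"
proof -
  obtain s t b where "\<And>a. f a = val (merge a b) s" "\<And>a. g a = val (merge a b) t"
    using is_term_common[OF assms] by metis
  moreover obtain A :: "nat \<Rightarrow> 'm set" where "range A \<subseteq> Sets M" using ex_assignment by blast
  ultimately show ?thesis by (intro definableI[of "Eq s t" A _ b]) (simp_all add: Sigma00.intros)
qed

lemma definable_less: 
  assumes "is_term f" "is_term g"
  shows "definable n (\<lambda>a. f a \<prec> g a)"
proof -
  obtain s t b where "\<And>a. f a = val (merge a b) s" "\<And>a. g a = val (merge a b) t"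
    using is_term_common[OF assms] by metis
  moreover obtain A :: "nat \<Rightarrow> 'm set" where "range A \<subseteq> Sets M" using ex_assignment by blast
  ultimately show ?thesis by (intro definableI[of "Lt s t" A _ b]) (simp_all add: Sigma00.intros)
qed

lemma definable_mem: "is_term f \<Longrightarrow> X \<in> Sets M \<Longrightarrow>
    definable n (\<lambda>a. f a \<in> X)"
  unfolding is_term_def by (elim exE, rule definableI[of "Mem _ 0" "\<lambda>_. X"]) (simp_all add: Sigma00.intros)

lemma definable_const: "definable n (\<lambda>a. c)"
  using definable_eq[OF is_term_const is_term_const, of n \<zero> \<zero>] definable_not[OF definable_eq[OF is_term_const is_term_const, of n \<zero> \<zero>]]
  by (cases c) auto

lemma Sigma1_induct:
  assumes "definable n (\<lambda>a. R (a 0) (a 1))" "\<exists>y. R \<zero> y" "\<And>x y. R x y \<Longrightarrow> \<exists>y. R (x \<oplus> \<one>) y"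
  shows "\<exists>y. R x y"
proof -
  from assms(1) obtain \<phi> A b where *: "Sigma00 \<phi>" "range A \<subseteq> Sets M" 
     "\<And>a. R (a 0) (a 1) \<longleftrightarrow> sat (merge a b) A \<phi>" unfolding definable_def by blast
  let ?a = "merge (\<lambda>_. \<zero>) b"
  have s: "sat (?a(0 := x)) A (ExN 2 \<phi>) \<longleftrightarrow> (\<exists>y. R x y)" for x
    using merge_upd[of _ b 0] merge_upd[of _ b 1] by (simp add: *(3)[symmetric])
  have "Sigma01 (ExN 2 \<phi>)" using * by (auto simp: Sigma01_def)
  moreover have "Sigma01_induction" using RCA0 unfolding RCA0_def by blast
  ultimately have "\<forall>n. sat (?a(0 := n)) A (ExN 2 \<phi>)" using assms(2,3) *(2)
    unfolding Sigma01_induction_def by (metis s)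
  then show ?thesis by (simp only: s)
qed

lemma Sigma00_induct:
  assumes "definable n (\<lambda>a. P (a 0))" "P \<zero>" "\<And>x. P x \<Longrightarrow> P (x \<oplus> \<one>)"
  shows "P x"
  using Sigma1_induct[of n "\<lambda>x y. P x" x] assms by blast

lemma Delta1_comprehension:
  assumes "definable m (\<lambda>a. R (a 0) (a 1))" "definable n (\<lambda>a. S (a 0) (a 1))" "\<And>x. (\<exists>y. R x y) \<longleftrightarrow> (\<forall>y. S x y)"
  shows "{x. \<exists>y. R x y} \<in> Sets M"
proof -
  from definable_common[OF assms(1,2)] obtain \<phi> \<psi> A b
    where *: "Sigma00 \<phi>" "Sigma00 \<psi>" "range A \<subseteq> Sets M" 
     "\<And>a. R (a 0) (a 1) \<longleftrightarrow>
         sat (merge a b) A \<phi>" "\<And>a. S (a 0) (a 1) \<longleftrightarrow> sat (merge a b) A \<psi>" by metis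
  let ?a = "merge (\<lambda>_. \<zero>) b"
  have s: "sat (?a(0 := x)) A (ExN 2 \<phi>) \<longleftrightarrow> (\<exists>y. R x y)"
    "sat (?a(0 := x)) A (AllN 2 \<psi>) \<longleftrightarrow> (\<forall>y. S x y)" for x
    using merge_upd[of _ b 0] merge_upd[of _ b 1] by (simp_all add: *(4,5)[symmetric])
  have "Sigma01 (ExN 2 \<phi>)" "Pi01 (AllN 2 \<psi>)" using * by (auto simp: Sigma01_def Pi01_def)
  moreover have "Delta01_comprehension" using RCA0 unfolding RCA0_def by blast
  ultimately have "\<exists>X\<in>Sets M. \<forall>n. n \<in> X \<longleftrightarrow>
      sat (?a(0 := n)) A (ExN 2 \<phi>)"
    using assms(3) *(3) unfolding Delta01_comprehension_def by (metis s)
  then obtain X where "X \<in> Sets M" "\<And>n. n \<in> X \<longleftrightarrow> (\<exists>y. R n y)"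
    by (auto simp only: s)
  moreover from this have "X = {x. \<exists>y. R x y}" by auto
  ultimately show ?thesis by simp
qed

lemma comprehension: "definable n (\<lambda>a. P (a 0)) \<Longrightarrow> {x. P x} \<in> Sets M"
  using Delta1_comprehension[of n "\<lambda>x y. P x" n "\<lambda>x y. P x"] by simp

lemmas base_intros = definable_eq definable_less definable_not definable_and definable_or definable_imp definable_iff definable_ex definable_all is_term_intros

lemma add_assoc': "(a \<oplus> b) \<oplus> c = a \<oplus> (b \<oplus> c)"
  by (rule Sigma00_induct[where x=c]) (rule base_intros | simp add: basic_simps)+

lemma zero_add': "\<zero> \<oplus> a = a"
  by (rule Sigma00_induct[where x=a]) (rule base_intros | simp add: basic_simps)+

lemma add_comm': "a \<oplus> b = b \<oplus> a"
proof -
  have *: "(x \<oplus> \<one>) \<oplus> y = (x \<oplus> y) \<oplus> \<one>" for x y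
    by (rule Sigma00_induct[where x=y]) (rule base_intros | simp add: basic_simps)+
  show ?thesis
    by (rule Sigma00_induct[where x=b]) (rule base_intros | simp add: basic_simps zero_add' *)+
qed

lemma add_left_comm': "a \<oplus> (b \<oplus> c) = b \<oplus> (a \<oplus> c)"
  by (metis add_assoc' add_comm')

lemma add_cancel':
  assumes "a \<oplus> c = b \<oplus> c"
  shows "a = b"
proof -
  have "a \<oplus> c = b \<oplus> c \<longrightarrow> a = b"
  proof (rule Sigma00_induct[where x=c])
    fix x assume "a \<oplus> x = b \<oplus> x \<longrightarrow> a = b"
    then show "a \<oplus> (x \<oplus> \<one>) = b \<oplus> (x \<oplus> \<one>) \<longrightarrow> a = b"
      using basic(2)[of "a \<oplus> x" "b \<oplus> x"] by (simp add: basic_simps)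
  qed (rule base_intros | simp add: basic_simps)+
  then show ?thesis using assms by blast
qed

lemma distrib_left': "a \<otimes> (b \<oplus> c) = a \<otimes> b \<oplus> a \<otimes> c"
proof (rule Sigma00_induct[where x=c])
  fix x assume "a \<otimes> (b \<oplus> x) = a \<otimes> b \<oplus> a \<otimes> x"
  then show "a \<otimes> (b \<oplus> (x \<oplus> \<one>)) = a \<otimes> b \<oplus> a \<otimes> (x \<oplus> \<one>)"
    by (simp only: basic(4,6)) (simp only: add_assoc')
qed (rule base_intros | simp add: basic_simps)+

lemma zero_mult': "\<zero> \<otimes> a = \<zero>"
  by (rule Sigma00_induct[where x=a]) (rule base_intros | simp add: basic_simps)+

lemma mult_one': "a \<otimes> \<one> = a"
  by (metis basic(5,6) zero_add')

lemma mult_comm': "a \<otimes> b = b \<otimes> a"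
proof -
  have *: "(x \<oplus> \<one>) \<otimes> y = (x \<otimes> y) \<oplus> y" for x y
  proof (rule Sigma00_induct[where x=y])
    fix z assume "(x \<oplus> \<one>) \<otimes> z = x \<otimes> z \<oplus> z"
    then show "(x \<oplus> \<one>) \<otimes> (z \<oplus> \<one>) = x \<otimes> (z \<oplus> \<one>) \<oplus> (z \<oplus> \<one>)"
      by (simp only: basic(6) add_assoc' add_left_comm'[of x] add_comm'[of x])
  qed (rule base_intros | simp add: basic_simps)+
  show ?thesis
    by (rule Sigma00_induct[where x=b]) (rule base_intros | simp add: basic_simps zero_mult' *)+
qed

lemma mult_assoc': "(a \<otimes> b) \<otimes> c = a \<otimes> (b \<otimes> c)"
  by (rule Sigma00_induct[where x=c]) (rule base_intros | simp add: basic_simps distrib_left' mult_one')+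

lemma less_iff_add: "m \<prec> n \<longleftrightarrow> (\<exists>d. n = m \<oplus> (d \<oplus> \<one>))"
proof
  have "\<exists>d. m \<prec> n \<longrightarrow> n = m \<oplus> (d \<oplus> \<one>)"
  proof (rule Sigma1_induct[where x=n])
    fix x y assume "m \<prec> x \<longrightarrow> x = m \<oplus> (y \<oplus> \<one>)"
    then show "\<exists>y. m \<prec> x \<oplus> \<one> \<longrightarrow>
        x \<oplus> \<one> = m \<oplus> (y \<oplus> \<one>)"
      by (metis basic(4,8) basic(3))
  qed (rule base_intros | simp add: basic_simps)+
  then show "m \<prec> n \<Longrightarrow> \<exists>d. n = m \<oplus> (d \<oplus> \<one>)" by blast
next
  have "m \<prec> m \<oplus> (d \<oplus> \<one>)" for d
    by (rule Sigma00_induct[where x=d]) (rule base_intros | simp add: basic_simps zero_add')+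
  then show "\<exists>d. n = m \<oplus> (d \<oplus> \<one>) \<Longrightarrow> m \<prec> n" by blast
qed

lemma zero_or_succ: "n = \<zero> \<or> (\<exists>d. n = d \<oplus> \<one>)"
proof -
  have "\<exists>d. n = \<zero> \<or> n = d \<oplus> \<one>"
    by (rule Sigma1_induct[where x=n]) (rule base_intros | blast)+
  then show ?thesis by blast
qed

lemma trichotomy: "m \<prec> n \<or> m = n \<or> n \<prec> m"
proof (rule Sigma00_induct[where x=n])
  show "m \<prec> \<zero> \<or> m = \<zero> \<or> \<zero> \<prec> m"
    using zero_or_succ[of m] by (auto simp: less_iff_add zero_add')
  fix x assume "m \<prec> x \<or> m = x \<or> x \<prec> m"
  moreover have "x \<oplus> \<one> = m \<or> x \<oplus> \<one> \<prec> m" if "x \<prec> m"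
  proof -
    from that obtain d where "m = x \<oplus> (d \<oplus> \<one>)" by (auto simp: less_iff_add)
    then have "m = (x \<oplus> \<one>) \<oplus> d" by (simp only: add_assoc' add_comm'[of d])
    then show ?thesis using zero_or_succ[of d] by (auto simp: less_iff_add basic(3))
  qed
  ultimately show "m \<prec> x \<oplus> \<one> \<or> m = x \<oplus> \<one> \<or>
      x \<oplus> \<one> \<prec> m" by (auto simp: basic_simps)
qed (rule base_intros)+

lemma add_eq_self: "a = a \<oplus> d \<Longrightarrow> d = \<zero>"
  by (metis add_cancel' add_comm' basic(3))

lemma less_irrefl': "\<not> a \<prec> a"
  using add_eq_self[of a] basic(1) by (auto simp: less_iff_add)

lemma less_trans': "a \<prec> b \<Longrightarrow> b \<prec> c \<Longrightarrow> a \<prec> c"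
  unfolding less_iff_add by (metis add_assoc')

definition le :: "'m \<Rightarrow> 'm \<Rightarrow> bool" (infix "\<preceq>" 50) where
  "x \<preceq> y \<longleftrightarrow> x \<prec> y \<or> x = y"

lemma le_iff_add': "x \<preceq> y \<longleftrightarrow> (\<exists>d. y = x \<oplus> d)"
  unfolding le_def less_iff_add
proof
  show "(\<exists>d. y = x \<oplus> (d \<oplus> \<one>)) \<or> x = y \<Longrightarrow>
      \<exists>d. y = x \<oplus> d" by (auto intro: exI[of _ \<zero>] simp: basic(3))
  assume "\<exists>d. y = x \<oplus> d"
  then obtain d where "y = x \<oplus> d" by blast
  then show "(\<exists>d. y = x \<oplus> (d \<oplus> \<one>)) \<or> x = y"
    using zero_or_succ[of d] by (auto simp: basic(3))
qed

definition minus :: "'m \<Rightarrow> 'm \<Rightarrow> 'm" where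
  "minus x y = (if y \<preceq> x then THE d. x = y \<oplus> d else \<zero>)"

lemma minus_add: "minus (x \<oplus> d) x = d"
proof -
  have "(THE e. x \<oplus> d = x \<oplus> e) = d"
    by (rule the_equality) (auto dest: add_cancel' simp: add_comm'[of x])
  then show ?thesis by (auto simp: minus_def le_iff_add')
qed

lemma minus_less: "x \<prec> y \<Longrightarrow> minus x y = \<zero>"
  using less_irrefl'[of x] less_trans'[of x y x] by (auto simp: minus_def le_def)

lemma minus_cases: obtains d where "x = y \<oplus> d" "minus x y = d" | "x \<prec> y" "minus x y = \<zero>"
proof (cases "y \<preceq> x")
  case True
  then show ?thesis using that(1) by (auto simp: le_iff_add' minus_add)
next
  case False
  then show ?thesis using that(2) trichotomy[of x y] by (auto simp: le_def minus_less)
qed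

lemma zero_minus: "minus \<zero> c = \<zero>"
proof (cases "c = \<zero>")
  case True
  then show ?thesis using minus_add[of \<zero> \<zero>] by (simp add: basic(3))
next
  case False
  then have "\<zero> \<prec> c" using trichotomy[of c \<zero>] basic(7) by blast
  then show ?thesis by (rule minus_less)
qed

sublocale ar: linordered_semidom "(\<oplus>)" minus "(\<preceq>)" "(\<prec>)" "\<zero>" "(\<otimes>)" "\<one>"
proof -
  have pos: "\<zero> \<prec> x \<longleftrightarrow> (\<exists>d. x = d \<oplus> \<one>)" for x
    by (simp add: less_iff_add zero_add')
  have ml: "c \<otimes> a \<prec> c \<otimes> b" if ab: "a \<prec> b" and c: "\<zero> \<prec> c" for a b c
  proof -
    obtain d e where "b = a \<oplus> (d \<oplus> \<one>)" "c = e \<oplus> \<one>"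
      using ab c unfolding pos unfolding less_iff_add by blast
    then show ?thesis unfolding less_iff_add
      by (intro exI[of _ "(e \<oplus> \<one>) \<otimes> d \<oplus> e"]) (simp only: distrib_left' mult_one' add_assoc')
  qed
  show "class.linordered_semidom (\<oplus>) minus (\<preceq>) (\<prec>) \<zero> (\<otimes>) \<one>"
  proof unfold_locales
    fix a b c :: 'm
    show "minus (minus a b) c = minus a (b \<oplus> c)"
    proof (cases "b \<oplus> c \<preceq> a")
      case True
      then obtain d where d: "a = (b \<oplus> c) \<oplus> d" by (auto simp: le_iff_add')
      moreover have "minus a b = c \<oplus> d" unfolding d add_assoc' by (rule minus_add)
      ultimately show ?thesis by (simp add: minus_add)
    next
      case False
      then have l: "a \<prec> b \<oplus> c" using trichotomy le_def by blast
      have "minus (minus a b) c = \<zero>"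
      proof (rule minus_cases[of a b])
        fix d assume d: "a = b \<oplus> d" "minus a b = d"
        show ?thesis
          by (rule minus_cases[of d c]) (use False d in \<open>auto simp: le_iff_add' add_assoc'\<close>)
      qed (simp add: zero_minus)
      then show ?thesis by (simp add: minus_less l)
    qed
    show "c \<otimes> minus a b = minus (c \<otimes> a) (c \<otimes> b)"
    proof (rule minus_cases[of a b])
      assume "a \<prec> b" "minus a b = \<zero>"
      moreover have "c = \<zero> \<or> \<zero> \<prec> c" using trichotomy[of c \<zero>] basic(7) by blast
      ultimately show ?thesis by (auto simp: basic(5) zero_mult' zero_minus minus_less ml)
    qed (simp add: distrib_left' minus_add)
    show "a \<noteq> \<zero> \<Longrightarrow> b \<noteq> \<zero> \<Longrightarrow> a \<otimes> b \<noteq> \<zero>"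
      using zero_or_succ[of a] zero_or_succ[of b] by (auto simp: basic_simps)
    show "a \<prec> b \<Longrightarrow> \<zero> \<prec> c \<Longrightarrow>
        c \<otimes> a \<prec> c \<otimes> b" by (rule ml)
    show "\<zero> \<prec> \<one>" using zero_add' pos by metis
    show "\<zero> \<noteq> \<one>" by (metis basic(1) zero_add')
    show "a \<preceq> b \<Longrightarrow> c \<oplus> a \<preceq> c \<oplus> b" by (auto simp: le_iff_add' add_assoc')
    show "b \<preceq> a \<Longrightarrow> minus a b \<oplus> b = a"
      by (auto simp: le_iff_add' minus_add add_comm'[of _ b])
    show "(a \<prec> b) = (a \<preceq> b \<and> \<not> b \<preceq> a)"
      unfolding le_def using less_irrefl' less_trans' by blast
    show "a \<preceq> a" "a \<preceq> b \<Longrightarrow> b \<preceq> c \<Longrightarrow>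
        a \<preceq> c" "a \<preceq> b \<Longrightarrow> b \<preceq> a \<Longrightarrow>
            a = b" "a \<preceq> b \<or> b \<preceq> a"
      unfolding le_def using less_irrefl' less_trans' trichotomy by blast+
    show "a \<oplus> b \<oplus> c = a \<oplus> (b \<oplus> c)" by (rule add_assoc')
    show "a \<oplus> b = b \<oplus> a" by (rule add_comm')
    show "\<zero> \<oplus> a = a" by (rule zero_add')
    show "a \<otimes> b \<otimes> c = a \<otimes> (b \<otimes> c)" by (rule mult_assoc')
    show "a \<otimes> b = b \<otimes> a" by (rule mult_comm')
    show "\<one> \<otimes> a = a" by (metis mult_one' mult_comm')
    show "(a \<oplus> b) \<otimes> c = a \<otimes> c \<oplus> b \<otimes> c" by (metis distrib_left' mult_comm')
    show "minus (a \<oplus> b) a = b" by (rule minus_add)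
    show "\<zero> \<otimes> a = \<zero>" by (rule zero_mult')
    show "a \<otimes> \<zero> = \<zero>" by (rule basic)
  qed (rule distrib_left')
qed

section \<open>Pairing and codes of finite sets\<close>

lemma less_succ: "x \<prec> y \<oplus> \<one> \<longleftrightarrow> x \<preceq> y"
  by (simp add: basic(8) le_def)

lemma succ_le: "x \<oplus> \<one> \<preceq> y \<longleftrightarrow> x \<prec> y"
  using less_succ[of y x] ar.not_le ar.not_less by blast

lemma zero_le: "\<zero> \<preceq> x"
  by (auto simp: le_iff_add' zero_add')

lemma le_add1: "x \<preceq> x \<oplus> y"
  by (auto simp: le_iff_add')

lemma le_add2: "y \<preceq> x \<oplus> y"
  by (metis le_add1 ar.add.commute)

lemma zero_less_succ: "\<zero> \<prec> x \<oplus> \<one>"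
  unfolding less_succ by (rule zero_le)

lemma succ_mult_le: "q \<preceq> (x \<oplus> \<one>) \<otimes> q"
  by (metis ar.distrib_right ar.mult_1_left le_add2)

lemma le_square: "x \<preceq> x \<otimes> x"
  using zero_or_succ[of x] succ_mult_le zero_le by metis

lemma fst_le_pr: "i \<preceq> \<langle>i, j\<rangle>"
  unfolding pr_def by (rule le_add2)

lemma snd_le_pr: "j \<preceq> \<langle>i, j\<rangle>"
  unfolding pr_def by (meson le_add1 le_add2 le_square ar.order_trans)

lemma pr_mono: "i \<preceq> i' \<Longrightarrow> j \<preceq> j' \<Longrightarrow>
    \<langle>i, j\<rangle> \<preceq> \<langle>i', j'\<rangle>"
  unfolding pr_def by (intro ar.add_mono ar.mult_mono zero_le)

lemma square_add_less:
  assumes "s \<prec> s'" "i \<preceq> s"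
  shows "s \<otimes> s \<oplus> i \<prec> s' \<otimes> s' \<oplus> i'"
proof -
  have "s \<otimes> s \<oplus> i \<preceq> s \<otimes> s \<oplus> s" using assms by (intro ar.add_mono) auto
  also have "\<dots> \<preceq> s \<otimes> s \<oplus> s \<oplus> s" by (rule le_add1)
  also have "\<dots> \<prec> (s \<oplus> \<one>) \<otimes> (s \<oplus> \<one>)"
    by (simp add: less_succ ar.distrib_left ar.distrib_right ar.add.assoc[symmetric])
  also have "\<dots> \<preceq> s' \<otimes> s'" using assms by (intro ar.mult_mono zero_le) (auto simp: succ_le)
  also have "\<dots> \<preceq> s' \<otimes> s' \<oplus> i'" by (rule le_add1)
  finally show ?thesis .
qed

lemma pr_eq_iff [simp]: "\<langle>i, j\<rangle> = \<langle>i', j'\<rangle> \<longleftrightarrow> i = i' \<and> j = j'"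
proof
  assume *: "\<langle>i, j\<rangle> = \<langle>i', j'\<rangle>"
  have "i \<oplus> j = i' \<oplus> j'"
    using square_add_less[of "i \<oplus> j" "i' \<oplus> j'" i i'] square_add_less[of "i' \<oplus> j'" "i \<oplus> j" i' i] *
      trichotomy[of "i \<oplus> j" "i' \<oplus> j'"] le_add1[of i j] le_add1[of i' j']
    unfolding pr_def by auto
  then show "i = i' \<and> j = j'" using * unfolding pr_def by simp
qed simp

lemma definable_any: "definable n R \<Longrightarrow> definable m R"
  unfolding definable_def .

lemma definable_le: "is_term f \<Longrightarrow> is_term g \<Longrightarrow>
    definable n (\<lambda>a. f a \<preceq> g a)"
  unfolding le_def by (intro definable_or definable_less definable_eq)

lemmas definable_intros = base_intros definable_le

lemma definable_subst1:
  assumes "definable m (\<lambda>a. P (a 0))" "is_term f"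
  shows "definable n (\<lambda>a. P (f a))"
  using definable_mem[OF assms(2) comprehension[of m P, OF assms(1)]] by simp

lemma definable_subst2:
  assumes "definable m (\<lambda>a. R (a (Suc 0)) (a (Suc (Suc 0))))" "is_term f" "is_term g"
  shows "definable n (\<lambda>a. R (f a) (g a))"
proof -
  let ?P = "\<lambda>p. \<exists>x. x \<prec> p \<oplus> \<one> \<and>
      (\<exists>y. y \<prec> p \<oplus> \<one> \<and> (p = \<langle>x, y\<rangle> \<and> R x y))"
  have "definable (Suc 0) (\<lambda>a. ?P (a 0))"
    by (rule definable_intros definable_any[OF assms(1)] | simp)+
  then have "definable n (\<lambda>a. ?P \<langle>f a, g a\<rangle>)"
    by (rule definable_subst1) (intro is_term_intros assms)
  then show ?thesis by (simp add: less_succ fst_le_pr snd_le_pr conj_commute cong: conj_cong)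
qed

lemma definable_subst3:
  assumes "definable m (\<lambda>a. R (a (Suc 0)) (a (Suc (Suc 0))) (a (Suc (Suc (Suc 0)))))" "is_term f" "is_term g" "is_term h"
  shows "definable n (\<lambda>a. R (f a) (g a) (h a))"
proof -
  let ?P = "\<lambda>p. \<exists>x. x \<prec> p \<oplus> \<one> \<and>
      (\<exists>y. y \<prec> p \<oplus> \<one> \<and> (\<exists>z. z \<prec> p \<oplus> \<one> \<and>
          (p = \<langle>\<langle>x, y\<rangle>, z\<rangle> \<and> R x y z)))"
  have "definable (Suc 0) (\<lambda>a. ?P (a 0))"
    by (rule definable_intros definable_any[OF assms(1)] | simp)+
  then have *: "definable n (\<lambda>a. ?P \<langle>\<langle>f a, g a\<rangle>, h a\<rangle>)"
    by (rule definable_subst1) (intro is_term_intros assms)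
  have "?P \<langle>\<langle>x, y\<rangle>, z\<rangle> \<longleftrightarrow> R x y z" for x y z
    using fst_le_pr[of "\<langle>x, y\<rangle>" z] snd_le_pr[of z "\<langle>x, y\<rangle>"] fst_le_pr[of x y] snd_le_pr[of y x]
    by (auto simp: less_succ intro: ar.order_trans)
  with * show ?thesis by (simp only: )
qed

abbreviation divides (infix "\<triangleleft>" 50) where "divides \<equiv> dvd.dvd (\<otimes>)"

lemma divides_iff: "x \<triangleleft> y \<longleftrightarrow> (\<exists>q. y = x \<otimes> q)"
  by (simp add: ar.dvd_def)

lemma divides_bounded: "x \<triangleleft> y \<longleftrightarrow>
    (\<exists>q. q \<prec> y \<oplus> \<one> \<and> y = x \<otimes> q)"
proof
  assume "x \<triangleleft> y"
  then obtain q where q: "y = x \<otimes> q" by (auto simp: divides_iff)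
  show "\<exists>q. q \<prec> y \<oplus> \<one> \<and> y = x \<otimes> q"
  proof (cases "x = \<zero>")
    case True
    then show ?thesis using q by (auto intro!: exI[of _ \<zero>] simp: less_succ)
  next
    case False
    then obtain z where "x = z \<oplus> \<one>" using zero_or_succ by blast
    then show ?thesis using q succ_mult_le by (auto intro!: exI[of _ q] simp: less_succ)
  qed
qed (auto simp: divides_iff)

lemma definable_divides: "is_term f \<Longrightarrow> is_term g \<Longrightarrow>
    definable n (\<lambda>a. f a \<triangleleft> g a)"
proof (rule definable_subst2)
  show "definable 3 (\<lambda>a. a (Suc 0) \<triangleleft> a (Suc (Suc 0)))" unfolding divides_bounded
    by (rule definable_intros | simp)+
qed

lemma elts_triple: "elts \<langle>k, \<langle>m, n\<rangle>\<rangle> = {i. i \<prec> k \<and>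
    (m \<otimes> (i \<oplus> \<one>) \<oplus> \<one>) \<triangleleft> n}"
  unfolding elts_def divides_iff by auto

lemma elts_less: "i \<in> elts c \<Longrightarrow> i \<prec> c"
  unfolding elts_def using fst_le_pr ar.less_le_trans by fast

lemma triple_bounds: "k \<prec> \<langle>k, \<langle>m, n\<rangle>\<rangle> \<oplus> \<one>" "m \<prec> \<langle>k, \<langle>m, n\<rangle>\<rangle> \<oplus> \<one>" "n \<prec> \<langle>k, \<langle>m, n\<rangle>\<rangle> \<oplus> \<one>"
  unfolding less_succ by (meson fst_le_pr snd_le_pr ar.order_trans)+

lemma elts_bounded: "i \<in> elts c \<longleftrightarrow>
    (\<exists>k. k \<prec> c \<oplus> \<one> \<and> (\<exists>m. m \<prec> c \<oplus> \<one> \<and>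
        (\<exists>n. n \<prec> c \<oplus> \<one> \<and>
   (c = \<langle>k, \<langle>m, n\<rangle>\<rangle> \<and> i \<prec> k \<and>
       (m \<otimes> (i \<oplus> \<one>) \<oplus> \<one>) \<triangleleft> n))))"
  unfolding elts_def divides_iff using triple_bounds by blast

lemma is_triple_bounded: "is_triple c \<longleftrightarrow>
    (\<exists>k. k \<prec> c \<oplus> \<one> \<and> (\<exists>m. m \<prec> c \<oplus> \<one> \<and>
        (\<exists>n. n \<prec> c \<oplus> \<one> \<and>
   (c = \<langle>k, \<langle>m, n\<rangle>\<rangle>))))"
  unfolding is_triple_def using triple_bounds by blast

lemma definable_elts: "is_term f \<Longrightarrow> is_term g \<Longrightarrow>
    definable n (\<lambda>a. f a \<in> elts (g a))"
proof (rule definable_subst2)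
  show "definable 3 (\<lambda>a. a (Suc 0) \<in> elts (a (Suc (Suc 0))))" unfolding elts_bounded
    by (rule definable_intros definable_divides | simp)+
qed

lemma definable_is_triple: "is_term f \<Longrightarrow> definable n (\<lambda>a. is_triple (f a))"
proof (rule definable_subst1)
  show "definable 1 (\<lambda>a. is_triple (a 0))" unfolding is_triple_bounded
    by (rule definable_intros | simp)+
qed

lemma elts_eq_bounded: "elts c = elts d \<longleftrightarrow>
    (\<forall>i. i \<prec> c \<oplus> d \<longrightarrow> (i \<in> elts c \<longleftrightarrow> i \<in> elts d))"
  using elts_less le_add1 le_add2 ar.less_le_trans by blast

lemma elts_subset_bounded: "elts c \<subseteq> X \<longleftrightarrow>
    (\<forall>i. i \<prec> c \<longrightarrow> (i \<in> elts c \<longrightarrow> i \<in> X))"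
  using elts_less by blast

lemma definable_elts_eq: "is_term f \<Longrightarrow> is_term g \<Longrightarrow>
    definable n (\<lambda>a. elts (f a) = elts (g a))"
proof (rule definable_subst2)
  show "definable 3 (\<lambda>a. elts (a (Suc 0)) = elts (a (Suc (Suc 0))))" unfolding elts_eq_bounded
    by (rule definable_intros definable_elts | simp)+
qed

lemma definable_elts_subset: "is_term f \<Longrightarrow> X \<in> Sets M \<Longrightarrow>
    definable n (\<lambda>a. elts (f a) \<subseteq> X)"
proof (rule definable_subst1)
  assume X: "X \<in> Sets M"
  show "definable 1 (\<lambda>a. elts (a 0) \<subseteq> X)" unfolding elts_subset_bounded
    by (rule definable_intros definable_elts definable_mem | simp add: X)+
qed

lemma is_code_bounded: "is_code c \<longleftrightarrow>
    is_triple c \<and> (\<forall>d. d \<prec> c \<longrightarrow> \<not> (is_triple d \<and> elts d = elts c))"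
  unfolding is_code_def by blast

lemma definable_is_code: "is_term f \<Longrightarrow> definable n (\<lambda>a. is_code (f a))"
proof (rule definable_subst1)
  show "definable 1 (\<lambda>a. is_code (a 0))" unfolding is_code_bounded
    by (rule definable_intros definable_elts_eq definable_is_triple | simp)+
qed

lemma is_function_bin: "is_function F {i. i \<prec> l} {\<zero>, \<one>} \<longleftrightarrow>
  (\<forall>p\<in>F. \<exists>x. x \<prec> l \<and> (p = \<langle>x, \<zero>\<rangle> \<or>
      p = \<langle>x, \<one>\<rangle>)) \<and>
  (\<forall>x. x \<prec> l \<longrightarrow> \<not> (\<langle>x, \<zero>\<rangle> \<in> F \<longleftrightarrow>
      \<langle>x, \<one>\<rangle> \<in> F))" (is "?L \<longleftrightarrow> ?R1 \<and> ?R2")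
proof -
  have "?L \<longleftrightarrow> ?R1 \<and> (\<forall>x. x \<prec> l \<longrightarrow>
      (\<exists>!y. \<langle>x, y\<rangle> \<in> F))"
    unfolding is_function_def by auto
  also have "\<dots> \<longleftrightarrow> ?R1 \<and> ?R2"
  proof (rule conj_cong[OF refl])
    assume r: ?R1
    have "(\<exists>!y. \<langle>x, y\<rangle> \<in> F) \<longleftrightarrow>
        \<not> (\<langle>x, \<zero>\<rangle> \<in> F \<longleftrightarrow> \<langle>x, \<one>\<rangle> \<in> F)" for x
    proof -
      have y: "y = \<zero> \<or> y = \<one>" if "\<langle>x, y\<rangle> \<in> F" for y using bspec[OF r that] by auto
      show ?thesis
      proof
        assume "\<exists>!y. \<langle>x, y\<rangle> \<in> F"
        then obtain z where z: "\<langle>x, z\<rangle> \<in> F" "\<And>y. \<langle>x, y\<rangle> \<in> F \<Longrightarrow> y = z" by blast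
        show "\<not> (\<langle>x, \<zero>\<rangle> \<in> F \<longleftrightarrow> \<langle>x, \<one>\<rangle> \<in> F)"
          using y[OF z(1)] z(1) z(2)[of \<zero>] z(2)[of \<one>] ar.zero_neq_one by (elim disjE) auto
      next
        assume "\<not> (\<langle>x, \<zero>\<rangle> \<in> F \<longleftrightarrow>
            \<langle>x, \<one>\<rangle> \<in> F)"
        then consider "\<langle>x, \<zero>\<rangle> \<in> F" "\<langle>x, \<one>\<rangle> \<notin> F" | "\<langle>x, \<one>\<rangle> \<in> F" "\<langle>x, \<zero>\<rangle> \<notin> F" by blast
        then show "\<exists>!y. \<langle>x, y\<rangle> \<in> F"
        proof cases
          case 1
          show ?thesis by (rule ex1I[of _ \<zero>]) (use 1 in \<open>auto dest: y\<close>)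
        next
          case 2
          show ?thesis by (rule ex1I[of _ \<one>]) (use 2 in \<open>auto dest: y\<close>)
        qed
      qed
    qed
    then show "(\<forall>x. x \<prec> l \<longrightarrow>
        (\<exists>!y. \<langle>x, y\<rangle> \<in> F)) \<longleftrightarrow> ?R2" by simp
  qed
  finally show ?thesis .
qed

lemma bin_seq_bounded: "bin_seq s l \<longleftrightarrow> is_code s \<and> 
  (\<forall>p. p \<prec> s \<longrightarrow> (p \<in> elts s \<longrightarrow>
      (\<exists>x. x \<prec> l \<and> (p = \<langle>x, \<zero>\<rangle> \<or>
          p = \<langle>x, \<one>\<rangle>)))) \<and>
  (\<forall>x. x \<prec> l \<longrightarrow>
      \<not> (\<langle>x, \<zero>\<rangle> \<in> elts s \<longleftrightarrow>
          \<langle>x, \<one>\<rangle> \<in> elts s))"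
  unfolding bin_seq_def is_function_bin Ball_def by (simp cong: conj_cong) (meson elts_less)

lemma definable_bin_seq: "is_term f \<Longrightarrow> is_term g \<Longrightarrow>
    definable n (\<lambda>a. bin_seq (f a) (g a))"
proof (rule definable_subst2)
  show "definable 3 (\<lambda>a. bin_seq (a (Suc 0)) (a (Suc (Suc 0))))" unfolding bin_seq_bounded
    by (rule definable_intros definable_elts definable_is_code | simp)+
qed

lemma ex_common_multiple: "\<exists>m. \<zero> \<prec> m \<and> (\<forall>i. i \<prec> b \<longrightarrow>
    (i \<oplus> \<one>) \<triangleleft> m)"
proof (rule Sigma1_induct[where x=b])
  fix x y assume "\<zero> \<prec> y \<and> (\<forall>i. i \<prec> x \<longrightarrow>
      (i \<oplus> \<one>) \<triangleleft> y)"
  then have "\<zero> \<prec> y \<otimes> (x \<oplus> \<one>) \<and>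
      (\<forall>i. i \<prec> x \<oplus> \<one> \<longrightarrow>
          (i \<oplus> \<one>) \<triangleleft> y \<otimes> (x \<oplus> \<one>))"
    by (simp only: basic(8)) (auto intro!: ar.mult_pos_pos ar.dvd_mult2 zero_less_succ)
  then show "\<exists>y. \<zero> \<prec> y \<and> (\<forall>i. i \<prec> x \<oplus> \<one> \<longrightarrow>
      (i \<oplus> \<one>) \<triangleleft> y)" by blast
next
  show "\<exists>y. \<zero> \<prec> y \<and> (\<forall>i. i \<prec> \<zero> \<longrightarrow>
      (i \<oplus> \<one>) \<triangleleft> y)" using ar.zero_less_one basic(7) by blast
  show "definable 2 (\<lambda>a. \<zero> \<prec> a 1 \<and> (\<forall>i. i \<prec> a 0 \<longrightarrow>
      (i \<oplus> \<one>) \<triangleleft> a 1))"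
    by (rule definable_intros definable_divides | simp)+
qed

lemma ex_product: "\<exists>p. \<zero> \<prec> p \<and> (\<forall>i. i \<prec> b \<longrightarrow>
    (m \<otimes> (i \<oplus> \<one>) \<oplus> \<one>) \<triangleleft> p)"
proof (rule Sigma1_induct[where x=b])
  fix x y assume "\<zero> \<prec> y \<and> (\<forall>i. i \<prec> x \<longrightarrow>
      (m \<otimes> (i \<oplus> \<one>) \<oplus> \<one>) \<triangleleft> y)"
  then have "\<zero> \<prec> y \<otimes> (m \<otimes> (x \<oplus> \<one>) \<oplus> \<one>) \<and>
    (\<forall>i. i \<prec> x \<oplus> \<one> \<longrightarrow>
        (m \<otimes> (i \<oplus> \<one>) \<oplus> \<one>) \<triangleleft> y \<otimes> (m \<otimes> (x \<oplus> \<one>) \<oplus> \<one>))"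
    by (simp only: basic(8)) (auto intro!: ar.mult_pos_pos ar.dvd_mult2 zero_less_succ)
  then show "\<exists>y. \<zero> \<prec> y \<and> (\<forall>i. i \<prec> x \<oplus> \<one> \<longrightarrow>
      (m \<otimes> (i \<oplus> \<one>) \<oplus> \<one>) \<triangleleft> y)" by blast
next
  show "\<exists>y. \<zero> \<prec> y \<and> (\<forall>i. i \<prec> \<zero> \<longrightarrow>
      (m \<otimes> (i \<oplus> \<one>) \<oplus> \<one>) \<triangleleft> y)" using ar.zero_less_one basic(7) by blast
  show "definable 2 (\<lambda>a. \<zero> \<prec> a 1 \<and> (\<forall>i. i \<prec> a 0 \<longrightarrow>
      (m \<otimes> (i \<oplus> \<one>) \<oplus> \<one>) \<triangleleft> a 1))"
    by (rule definable_intros definable_divides | simp)+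
qed

lemma ex_remainder:
  assumes "\<zero> \<prec> p"
  shows "\<exists>q r. r \<prec> p \<and> n = p \<otimes> q \<oplus> r"
proof -
  have "\<exists>q. \<exists>r. r \<prec> p \<and> n = p \<otimes> q \<oplus> r"
  proof (rule Sigma1_induct[where x=n])
    fix x q assume "\<exists>r. r \<prec> p \<and> x = p \<otimes> q \<oplus> r"
    then obtain r where r: "r \<prec> p" "x = p \<otimes> q \<oplus> r" by blast
    show "\<exists>q r. r \<prec> p \<and> x \<oplus> \<one> = p \<otimes> q \<oplus> r"
    proof (cases "r \<oplus> \<one> = p")
      case True
      then have "x \<oplus> \<one> = p \<otimes> (q \<oplus> \<one>) \<oplus> \<zero>"
        using r by (simp add: basic(6) add_assoc')
      then show ?thesis using assms by blast
    next
      case False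
      then have "r \<oplus> \<one> \<prec> p" using r succ_le[of r p] by (auto simp: le_def)
      then show ?thesis using r by (intro exI[of _ q] exI[of _ "r \<oplus> \<one>"]) (simp add: add_assoc')
    qed
  next
    show "\<exists>y r. r \<prec> p \<and> \<zero> = p \<otimes> y \<oplus> r"
      using assms by (auto intro!: exI[of _ \<zero>])
    show "definable 2 (\<lambda>a. \<exists>r. r \<prec> p \<and> a 0 = p \<otimes> a 1 \<oplus> r)"
      by (rule definable_intros | simp)+
  qed
  then show ?thesis .
qed

lemma divides_cancel_modulus:
  assumes d: "d = m \<otimes> j \<oplus> \<one>" and "d \<triangleleft> m \<otimes> n"
  shows "d \<triangleleft> n"
proof -
  have "d \<otimes> n = (m \<otimes> n) \<otimes> j \<oplus> n"
    unfolding d by (simp add: ar.distrib_right ar.mult.assoc ar.mult.commute[of j])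
  moreover have "d \<triangleleft> (m \<otimes> n) \<otimes> j" using assms(2) by (rule ar.dvd_mult2)
  ultimately show ?thesis using ar.dvd_add_right_iff ar.dvd_triv_left[of d n] by simp
qed

lemma moduli_coprime:
  assumes "i \<prec> j" "j \<prec> b" "\<forall>i. i \<prec> b \<longrightarrow>
      (i \<oplus> \<one>) \<triangleleft> m"
    and u: "u = m \<otimes> (i \<oplus> \<one>) \<oplus> \<one>"
      and v: "v = m \<otimes> (j \<oplus> \<one>) \<oplus> \<one>"
  shows "u \<triangleleft> n \<otimes> v \<Longrightarrow>
      u \<triangleleft> n" "v \<triangleleft> n \<otimes> u \<Longrightarrow> v \<triangleleft> n"
proof -
  obtain e where e: "j = i \<oplus> (e \<oplus> \<one>)" using assms(1) by (auto simp: less_iff_add)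
  then have "e \<prec> j" using le_add2[of "e \<oplus> \<one>" i] unfolding succ_le by blast
  then have "(e \<oplus> \<one>) \<triangleleft> m" using assms ar.less_trans by blast
  then obtain c where c: "m = (e \<oplus> \<one>) \<otimes> c" by (auto simp: divides_iff)
  have vu: "v = u \<oplus> m \<otimes> (e \<oplus> \<one>)" unfolding u v e
    by (simp only: ar.distrib_left ar.add.assoc ar.add.left_commute ar.add.commute)
  have nvu: "n \<otimes> v = n \<otimes> u \<oplus> m \<otimes> n \<otimes> (e \<oplus> \<one>)" unfolding vu
    by (simp add: ar.distrib_left ar.mult.assoc ar.mult.left_commute ar.mult.commute)
  have *: "d \<triangleleft> n" if "d = m \<otimes> x \<oplus> \<one>" "d \<triangleleft> m \<otimes> n \<otimes> (e \<oplus> \<one>)" for d x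
  proof -
    have "d \<triangleleft> m \<otimes> n \<otimes> (e \<oplus> \<one>) \<otimes> c"
      using that(2) by (rule ar.dvd_mult2)
    also have "m \<otimes> n \<otimes> (e \<oplus> \<one>) \<otimes> c = m \<otimes> (m \<otimes> n)"
      by (subst (2) c) (simp only: ar.mult.assoc ar.mult.left_commute ar.mult.commute)
    finally show ?thesis using divides_cancel_modulus[OF that(1)] by blast
  qed
  show "u \<triangleleft> n" if "u \<triangleleft> n \<otimes> v"
    using that *[OF u] ar.dvd_add_right_iff[OF ar.dvd_triv_right[of u n]] unfolding nvu by blast
  show "v \<triangleleft> n" if "v \<triangleleft> n \<otimes> u"
    using *[OF v] ar.dvd_add_right_iff[OF that] ar.dvd_triv_right[of v n] unfolding nvu by blast
qed

lemma ex_triple: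
  assumes "\<zero> \<prec> m"
    and m: "\<forall>i. i \<prec> b \<longrightarrow> (i \<oplus> \<one>) \<triangleleft> m" and X: "X \<in> Sets M"
  shows "\<exists>n. \<forall>i. i \<prec> b \<longrightarrow>
      ((m \<otimes> (i \<oplus> \<one>) \<oplus> \<one>) \<triangleleft> n \<longleftrightarrow> i \<in> X)"
proof -
  let ?d = "\<lambda>i. m \<otimes> (i \<oplus> \<one>) \<oplus> \<one>"
  have "\<exists>n. \<forall>i. i \<prec> b \<longrightarrow> (?d i \<triangleleft> n \<longleftrightarrow>
      i \<prec> j \<and> i \<in> X)" for j
  proof (rule Sigma1_induct[where x=j])
    show "definable 2 (\<lambda>a. \<forall>i. i \<prec> b \<longrightarrow>
        (?d i \<triangleleft> a 1 \<longleftrightarrow> i \<prec> a 0 \<and> i \<in> X))"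
      by (rule definable_intros definable_divides definable_mem | simp add: X)+
    have "\<not> ?d i \<triangleleft> \<one>" for i
    proof
      assume "?d i \<triangleleft> \<one>"
      then obtain q where q: "\<one> = ?d i \<otimes> q" by (auto simp: divides_iff)
      then have "q \<noteq> \<zero>" by auto
      then have "?d i \<preceq> \<one>" using q zero_or_succ[of q] succ_mult_le[of "?d i"] by (metis mult_comm')
      moreover have "\<zero> \<prec> m \<otimes> (i \<oplus> \<one>)"
        using assms(1) by (intro ar.mult_pos_pos zero_less_succ)
      ultimately show False unfolding succ_le using less_succ[of _ \<zero>] zero_add' ar.not_le by metis
    qed
    then show "\<exists>n. \<forall>i. i \<prec> b \<longrightarrow>
        (?d i \<triangleleft> n \<longleftrightarrow> i \<prec> \<zero> \<and> i \<in> X)" using basic(7) by blast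
    fix j n assume IH: "\<forall>i. i \<prec> b \<longrightarrow> (?d i \<triangleleft> n \<longleftrightarrow>
        i \<prec> j \<and> i \<in> X)"
    show "\<exists>n. \<forall>i. i \<prec> b \<longrightarrow> (?d i \<triangleleft> n \<longleftrightarrow>
        i \<prec> j \<oplus> \<one> \<and> i \<in> X)"
    proof (cases "j \<in> X \<and> j \<prec> b")
      case False
      then show ?thesis using IH by (intro exI[of _ n]) (auto simp: basic(8))
    next
      case True
      have "?d i \<triangleleft> n \<otimes> ?d j \<longleftrightarrow>
          i \<prec> j \<oplus> \<one> \<and> i \<in> X" if "i \<prec> b" for i
      proof (cases "i = j")
        case True
        then show ?thesis using \<open>j \<in> X \<and> j \<prec> b\<close> by (simp add: basic(8))
      next
        case False
        then have "?d i \<triangleleft> n \<otimes> ?d j \<longleftrightarrow> ?d i \<triangleleft> n"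
          using moduli_coprime(1)[of i j b m "?d i" "?d j" n] moduli_coprime(2)[of j i b m "?d j" "?d i" n]
            trichotomy[of i j] m True that ar.dvd_mult2 by blast
        then show ?thesis using IH that False by (auto simp: basic(8))
      qed
      then show ?thesis by blast
    qed
  qed
  from this[of b] show ?thesis by blast
qed

lemma least_number:
  assumes "definable n (\<lambda>a. P (a 0))" "P x"
  shows "\<exists>y. P y \<and> (\<forall>z. z \<prec> y \<longrightarrow> \<not> P z)"
proof (rule ccontr)
  assume *: "\<not> ?thesis"
  have "\<forall>y. y \<prec> x \<oplus> \<one> \<longrightarrow> \<not> P y"
  proof (rule Sigma00_induct[where x="x \<oplus> \<one>"])
    have "definable m (\<lambda>a. P (a i))" for m i using definable_subst1[OF assms(1)] is_term_var by blast
    note P = this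
    show "definable 1 (\<lambda>a. \<forall>y. y \<prec> a 0 \<longrightarrow> \<not> P y)"
      by (rule definable_intros P | simp)+
  next
    fix u assume "\<forall>y. y \<prec> u \<longrightarrow> \<not> P y"
    then show "\<forall>y. y \<prec> u \<oplus> \<one> \<longrightarrow> \<not> P y" using * basic(8) by blast
  qed (simp add: basic)
  then show False using assms(2) basic(8) by blast
qed

lemma code_of_triple: "is_triple c \<Longrightarrow> \<exists>d. is_code d \<and> elts d = elts c"
proof -
  assume c: "is_triple c"
  have "definable 1 (\<lambda>a. is_triple (a 0) \<and> elts (a 0) = elts c)"
    by (rule definable_intros definable_is_triple definable_elts_eq)+
  from least_number[of 1 "\<lambda>d. is_triple d \<and> elts d = elts c", OF this] c
  obtain d where "is_triple d" "elts d = elts c" "\<forall>z. z \<prec> d \<longrightarrow>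
      \<not> (is_triple z \<and> elts z = elts c)" by blast
  then show ?thesis unfolding is_code_def by (intro exI[of _ d]) auto
qed

lemma elts_in_Sets: "elts c \<in> Sets M"
  using comprehension[of 1 "\<lambda>x. x \<in> elts c"] definable_elts[OF is_term_var is_term_const] by simp

lemma ex_code:
  assumes "X \<in> Sets M" "\<And>x. x \<in> X \<Longrightarrow> x \<prec> b"
  shows "\<exists>c. is_code c \<and> elts c = X"
proof -
  obtain m where "\<zero> \<prec> m" "\<forall>i. i \<prec> b \<longrightarrow>
      (i \<oplus> \<one>) \<triangleleft> m" using ex_common_multiple by blast
  from ex_triple[OF this assms(1)] obtain n where
    n: "\<forall>i. i \<prec> b \<longrightarrow>
        ((m \<otimes> (i \<oplus> \<one>) \<oplus> \<one>) \<triangleleft> n \<longleftrightarrow>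
            i \<in> X)" by blast
  then have "elts \<langle>b, \<langle>m, n\<rangle>\<rangle> = X" using assms(2) by (auto simp: elts_triple)
  then show ?thesis using code_of_triple[of "\<langle>b, \<langle>m, n\<rangle>\<rangle>"]
    by (auto simp: is_triple_def)
qed

text \<open>Replacing \<open>n\<close> by its remainder modulo a common multiple \<open>p\<close> of the moduli does not change
  the finite set that is coded.\<close>

lemma codes_bounded: "\<exists>B. \<forall>c. is_code c \<longrightarrow>
    (\<forall>i\<in>elts c. i \<prec> b) \<longrightarrow> c \<preceq> B"
proof -
  obtain m where m: "\<zero> \<prec> m" "\<forall>i. i \<prec> b \<longrightarrow>
      (i \<oplus> \<one>) \<triangleleft> m" using ex_common_multiple by blast
  obtain p where p: "\<zero> \<prec> p" "\<forall>i. i \<prec> b \<longrightarrow>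
      (m \<otimes> (i \<oplus> \<one>) \<oplus> \<one>) \<triangleleft> p" using ex_product by blast
  have "c \<preceq> \<langle>b, \<langle>m, p\<rangle>\<rangle>" if c: "is_code c" "\<forall>i\<in>elts c. i \<prec> b" for c
  proof -
    from ex_triple[OF m elts_in_Sets] obtain n where
      n: "\<forall>i. i \<prec> b \<longrightarrow>
          ((m \<otimes> (i \<oplus> \<one>) \<oplus> \<one>) \<triangleleft> n \<longleftrightarrow>
              i \<in> elts c)" by blast
    obtain q r where r: "r \<prec> p" "n = p \<otimes> q \<oplus> r" using ex_remainder[OF p(1)] by blast
    have "(m \<otimes> (i \<oplus> \<one>) \<oplus> \<one>) \<triangleleft> r \<longleftrightarrow>
        i \<in> elts c" if "i \<prec> b" for i
    proof -
      have "(m \<otimes> (i \<oplus> \<one>) \<oplus> \<one>) \<triangleleft> p \<otimes> q"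
        using p(2) that by (intro ar.dvd_mult2) blast
      from ar.dvd_add_right_iff[OF this, of r] show ?thesis using n that r(2) by simp
    qed
    then have "elts \<langle>b, \<langle>m, r\<rangle>\<rangle> = elts c" using c(2) by (auto simp: elts_triple)
    then have "c \<preceq> \<langle>b, \<langle>m, r\<rangle>\<rangle>" using c(1) ar.not_le
      unfolding is_code_def is_triple_def by blast
    also have "\<dots> \<preceq> \<langle>b, \<langle>m, p\<rangle>\<rangle>"
      using r(1) by (intro pr_mono) (auto simp: le_def)
    finally show ?thesis .
  qed
  then show ?thesis by blast
qed

section \<open>Colorings from paths\<close>

lemma bin_seq_elt:
  assumes "bin_seq s l" "\<langle>x, y\<rangle> \<in> elts s"
  shows "x \<prec> l" "y = \<zero> \<or> y = \<one>"
proof -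
  have "\<exists>z. z \<prec> l \<and> (\<langle>x, y\<rangle> = \<langle>z, \<zero>\<rangle> \<or>
      \<langle>x, y\<rangle> = \<langle>z, \<one>\<rangle>)"
    using assms unfolding bin_seq_def is_function_bin by blast
  then show "x \<prec> l" "y = \<zero> \<or> y = \<one>" by auto
qed

lemma bin_seq_is_pair:
  assumes "bin_seq s l" "p \<in> elts s"
  obtains x y where "p = \<langle>x, y\<rangle>" "x \<prec> l" "y = \<zero> \<or> y = \<one>"
  using assms unfolding bin_seq_def is_function_bin by blast

lemma bin_seq_value:
  assumes "bin_seq s l" "x \<prec> l"
  shows "\<langle>x, \<zero>\<rangle> \<in> elts s \<longleftrightarrow> \<langle>x, \<one>\<rangle> \<notin> elts s"
  using assms unfolding bin_seq_def is_function_bin by blast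

lemma bin_seq_total:
  assumes "bin_seq s l" "x \<prec> l"
  obtains y where "y = \<zero> \<or> y = \<one>" "\<langle>x, y\<rangle> \<in> elts s"
  using bin_seq_value[OF assms] by blast

lemma bin_seq_unique:
  assumes "bin_seq s l" "\<langle>x, y\<rangle> \<in> elts s" "\<langle>x, z\<rangle> \<in> elts s"
  shows "y = z"
  using bin_seq_elt[OF assms(1,2)] bin_seq_elt[OF assms(1,3)] bin_seq_value[OF assms(1), of x] assms(2,3)
  by auto

lemma bin_seq_length_le: "bin_seq s l \<Longrightarrow> l \<preceq> s"
proof (rule ccontr)
  assume s: "bin_seq s l" "\<not> l \<preceq> s"
  then have "s \<prec> l" by (simp add: ar.not_le)
  then obtain y where "\<langle>s, y\<rangle> \<in> elts s" by (rule bin_seq_total[OF s(1)])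
  then have "\<langle>s, y\<rangle> \<prec> s" by (rule elts_less)
  with fst_le_pr[of s y] show False by (simp add: ar.not_less[symmetric])
qed

lemma bin_seq_subset_length:
  assumes "bin_seq t l'" "bin_seq s l" "elts t \<subseteq> elts s"
  shows "l' \<preceq> l"
proof (rule ccontr)
  assume "\<not> l' \<preceq> l"
  then have "l \<prec> l'" by (simp add: ar.not_le)
  then obtain y where "\<langle>l, y\<rangle> \<in> elts t" by (rule bin_seq_total[OF assms(1)])
  then have "l \<prec> l" using bin_seq_elt(1)[OF assms(2)] assms(3) by blast
  then show False by simp
qed

lemma bin_seq_length_unique: "bin_seq s l \<Longrightarrow> bin_seq s l' \<Longrightarrow> l = l'"
  by (rule ar.order_antisym) (auto intro: bin_seq_subset_length)

lemma bin_seq_subset_agree: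
  assumes "bin_seq t l" "elts t \<subseteq> F" "x \<prec> l" "\<And>y z. \<langle>x, y\<rangle> \<in> F \<Longrightarrow> \<langle>x, z\<rangle> \<in> F \<Longrightarrow> y = z"
  shows "\<langle>x, y\<rangle> \<in> elts t \<longleftrightarrow> \<langle>x, y\<rangle> \<in> F"
proof
  assume y: "\<langle>x, y\<rangle> \<in> F"
  obtain z where "\<langle>x, z\<rangle> \<in> elts t" by (rule bin_seq_total[OF assms(1,3)])
  moreover from this have "y = z" using y assms(2,4) by blast
  ultimately show "\<langle>x, y\<rangle> \<in> elts t" by simp
qed (use assms(2) in blast)

lemma ex_bin_seq:
  assumes X: "X \<in> Sets M"
  shows "\<exists>s. bin_seq s l \<and> (\<forall>x. x \<prec> l \<longrightarrow>
      (\<langle>x, \<one>\<rangle> \<in> elts s \<longleftrightarrow> x \<in> X))"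
proof -
  let ?P = "\<lambda>p. \<exists>x. x \<prec> l \<and> (x \<in> X \<and> p = \<langle>x, \<one>\<rangle> \<or>
      x \<notin> X \<and> p = \<langle>x, \<zero>\<rangle>)"
  have "definable 1 (\<lambda>a. ?P (a 0))" by (rule definable_intros definable_mem | simp add: X)+
  then have S: "{p. ?P p} \<in> Sets M" by (rule comprehension)
  have "p \<prec> \<langle>l, \<one>\<rangle> \<oplus> \<one>" if "p \<in> {p. ?P p}" for p
    using that unfolding less_succ by (auto intro!: pr_mono zero_le intro: ar.less_imp_le)
  from ex_code[OF S this] obtain s where s: "is_code s" "elts s = {p. ?P p}" by blast
  then have "bin_seq s l" unfolding bin_seq_def is_function_bin by auto
  moreover have "\<forall>x. x \<prec> l \<longrightarrow>
      (\<langle>x, \<one>\<rangle> \<in> elts s \<longleftrightarrow> x \<in> X)" using s(2) by auto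
  ultimately show ?thesis by blast
qed

lemma ex_bin_seq_append:
  assumes s: "bin_seq s l" and y: "y = \<zero> \<or> y = \<one>"
  shows "\<exists>t. bin_seq t (l \<oplus> \<one>) \<and> elts t = insert \<langle>l, y\<rangle> (elts s)"
proof -
  have "definable 1 (\<lambda>a. a 0 = \<langle>l, y\<rangle> \<or> a 0 \<in> elts s)"
    by (rule definable_intros definable_elts)+
  then have S: "{p. p = \<langle>l, y\<rangle> \<or> p \<in> elts s} \<in> Sets M" by (rule comprehension)
  have "p \<prec> (\<langle>l, y\<rangle> \<oplus> s) \<oplus> \<one>" if "p \<in> {p. p = \<langle>l, y\<rangle> \<or> p \<in> elts s}" for p
  proof -
    from that consider "p = \<langle>l, y\<rangle>" | "p \<prec> s" using elts_less by blast
    then show ?thesis unfolding less_succ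
      by cases (use le_add1 le_add2 ar.order_trans ar.less_imp_le in blast)+
  qed
  from ex_code[OF S this] obtain t where t: "is_code t" "elts t = insert \<langle>l, y\<rangle> (elts s)" by auto
  have "is_function (elts t) {i. i \<prec> l \<oplus> \<one>} {\<zero>, \<one>}" unfolding is_function_bin
  proof (intro conjI ballI allI impI)
    fix p assume "p \<in> elts t"
    then consider "p = \<langle>l, y\<rangle>" | "p \<in> elts s" using t(2) by blast
    then show "\<exists>x. x \<prec> l \<oplus> \<one> \<and> (p = \<langle>x, \<zero>\<rangle> \<or>
        p = \<langle>x, \<one>\<rangle>)"
    proof cases
      case 1
      then show ?thesis using y by (auto simp: less_succ)
    next
      case 2
      then show ?thesis by (rule bin_seq_is_pair[OF s]) (auto simp: basic(8))
    qed
  next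
    fix x assume "x \<prec> l \<oplus> \<one>"
    then consider "x = l" | "x \<prec> l" "x \<noteq> l" by (auto simp: basic(8))
    then show "\<not> (\<langle>x, \<zero>\<rangle> \<in> elts t \<longleftrightarrow>
        \<langle>x, \<one>\<rangle> \<in> elts t)"
    proof cases
      case 1
      have "\<langle>l, z\<rangle> \<notin> elts s" for z using bin_seq_elt(1)[OF s, of l z] by auto
      then show ?thesis using 1 y t(2) by auto
    next
      case 2
      then show ?thesis using bin_seq_value[OF s] t(2) by auto
    qed
  qed
  then show ?thesis using t unfolding bin_seq_def by blast
qed

lemma bin_seq_append_elts:
  assumes s: "bin_seq s l" and t: "bin_seq t (l \<oplus> \<one>)"
    and "elts s \<subseteq> elts t" "\<langle>l, y\<rangle> \<in> elts t"
  shows "elts t = insert \<langle>l, y\<rangle> (elts s)"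
proof
  show "elts t \<subseteq> insert \<langle>l, y\<rangle> (elts s)"
  proof
    fix p assume p: "p \<in> elts t"
    then obtain x z where x: "p = \<langle>x, z\<rangle>" "x \<prec> l \<oplus> \<one>"
      by (rule bin_seq_is_pair[OF t])
    show "p \<in> insert \<langle>l, y\<rangle> (elts s)"
    proof (cases "x = l")
      case True
      then show ?thesis using bin_seq_unique[OF t, of l y z] assms(4) p x by simp
    next
      case False
      then have "x \<prec> l" using x by (simp add: basic(8))
      then show ?thesis
        using bin_seq_subset_agree[OF s assms(3), of x z] bin_seq_unique[OF t, of x] p x by blast
    qed
  qed
qed (use assms in blast)

lemma WKL_imp_coloring:
  assumes WKL and V: "V \<in> Sets M" and f: "f \<in> Sets M"
    and hyp: "is_hypergraph V (seq_range f)"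
    and fin: "finitely_colorable Q k V (seq_range f)"
    and Q: "\<And>E \<chi>. Q E \<chi> \<longleftrightarrow> (\<forall>e\<in>E. q e \<chi>)"
    and local: "\<And>e \<chi> \<chi>'. (\<And>v j. v \<in> elts e \<Longrightarrow>
        \<langle>v, j\<rangle> \<in> \<chi> \<longleftrightarrow>
            \<langle>v, j\<rangle> \<in> \<chi>') \<Longrightarrow> q e \<chi> \<Longrightarrow> q e \<chi>'"
    and definable_q: "\<And>n f g W. is_term f \<Longrightarrow> is_term g \<Longrightarrow>
        W \<in> Sets M \<Longrightarrow>
      definable n (\<lambda>a. q (f a) {p \<in> W. \<langle>p, \<one>\<rangle> \<in> elts (g a)})"
  shows "has_coloring Q k V (seq_range f)"
proof -
  define K where "K = num k"
  define W where "W = {p. \<exists>v. v \<prec> p \<oplus> \<one> \<and> (\<exists>j. j \<prec> K \<and>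
      (p = \<langle>v, j\<rangle> \<and> v \<in> V))}"
  have "definable 1 (\<lambda>a. \<exists>v. v \<prec> a 0 \<oplus> \<one> \<and>
      (\<exists>j. j \<prec> K \<and> (a 0 = \<langle>v, j\<rangle> \<and> v \<in> V)))"
    by (rule definable_intros definable_mem | simp add: V)+
  then have W: "W \<in> Sets M" unfolding W_def by (rule comprehension)
  have W_iff: "p \<in> W \<longleftrightarrow>
      (\<exists>v j. p = \<langle>v, j\<rangle> \<and> v \<in> V \<and> j \<prec> K)" for p
    unfolding W_def by (auto simp: less_succ fst_le_pr)
  define G where "G l B \<longleftrightarrow>
      (\<forall>v\<in>V. \<langle>v, K\<rangle> \<prec> l \<longrightarrow>
          (\<exists>!j. \<langle>v, j\<rangle> \<in> {p \<in> W. p \<in> B})) \<and>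
    (\<forall>e i. e \<prec> l \<longrightarrow> i \<prec> l \<longrightarrow>
        \<langle>i, e\<rangle> \<in> f \<longrightarrow>
            (\<forall>v\<in>elts e. \<langle>v, K\<rangle> \<prec> l) \<longrightarrow>
                q e {p \<in> W. p \<in> B})" for l B
  have G_mono: "G l' B'" if G: "G l B" and l: "l' \<preceq> l"
    and B: "\<And>p. p \<prec> l' \<Longrightarrow> p \<in> B \<longleftrightarrow> p \<in> B'" for l l' B B'
  proof -
    have eq: "\<langle>v, j\<rangle> \<in> {p \<in> W. p \<in> B} \<longleftrightarrow>
        \<langle>v, j\<rangle> \<in> {p \<in> W. p \<in> B'}" if "\<langle>v, K\<rangle> \<prec> l'" for v j
    proof (cases "\<langle>v, j\<rangle> \<in> W")
      case True
      then have "\<langle>v, j\<rangle> \<preceq> \<langle>v, K\<rangle>"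
        unfolding W_iff by (auto intro!: pr_mono zero_le intro: ar.less_imp_le)
      then show ?thesis using B that ar.le_less_trans by blast
    qed simp
    have lt: "x \<prec> l" if "x \<prec> l'" for x using that l by (rule ar.less_le_trans)
    show ?thesis unfolding G_def
    proof (intro conjI ballI allI impI)
      fix v assume v: "v \<in> V" "\<langle>v, K\<rangle> \<prec> l'"
      show "\<exists>!j. \<langle>v, j\<rangle> \<in> {p \<in> W. p \<in> B'}"
        using G lt[OF v(2)] v(1) unfolding G_def eq[OF v(2), symmetric] by blast
    next
      fix e i assume e: "e \<prec> l'" "i \<prec> l'" "\<langle>i, e\<rangle> \<in> f" "\<forall>v\<in>elts e. \<langle>v, K\<rangle> \<prec> l'"
      then have "q e {p \<in> W. p \<in> B}" using G lt unfolding G_def by blast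
      then show "q e {p \<in> W. p \<in> B'}" by (rule local[rotated]) (use e(4) eq in blast)
    qed
  qed
  define T where "T = {s. \<exists>l. bin_seq s l \<and> G l {p. \<langle>p, \<one>\<rangle> \<in> elts s}}"
  have "T = {s. \<exists>l. l \<prec> s \<oplus> \<one> \<and> (bin_seq s l \<and> 
     (\<forall>v. v \<prec> l \<longrightarrow> (v \<in> V \<longrightarrow>
         (\<langle>v, K\<rangle> \<prec> l \<longrightarrow>
             (\<exists>j. j \<prec> K \<and> ((\<langle>v, j\<rangle> \<in> W \<and>
                 \<langle>\<langle>v, j\<rangle>, \<one>\<rangle> \<in> elts s) \<and>
        (\<forall>j'. j' \<prec> K \<longrightarrow>
            (\<langle>v, j'\<rangle> \<in> W \<and>
                \<langle>\<langle>v, j'\<rangle>, \<one>\<rangle> \<in> elts s \<longrightarrow> j' = j))))))) \<and>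
     (\<forall>e. e \<prec> l \<longrightarrow> (\<forall>i. i \<prec> l \<longrightarrow>
         (\<langle>i, e\<rangle> \<in> f \<longrightarrow>
        ((\<forall>v. v \<prec> e \<longrightarrow> (v \<in> elts e \<longrightarrow>
            \<langle>v, K\<rangle> \<prec> l)) \<longrightarrow>
                q e {p \<in> W. \<langle>p, \<one>\<rangle> \<in> elts s})))))}"
    (is "T = {s. \<exists>l. l \<prec> s \<oplus> \<one> \<and> (bin_seq s l \<and> ?A s l \<and> ?B s l)}")
  proof -
    have A: "(\<forall>v\<in>V. \<langle>v, K\<rangle> \<prec> l \<longrightarrow>
        (\<exists>!j. \<langle>v, j\<rangle> \<in> {p \<in> W. p \<in> {p. \<langle>p, \<one>\<rangle> \<in> elts s}})) \<longleftrightarrow> ?A s l" for s l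
    proof -
      have 1: "v \<prec> l" if "\<langle>v, K\<rangle> \<prec> l" for v
        using fst_le_pr that by (rule ar.le_less_trans)
      have 2: "j \<prec> K" if "\<langle>v, j\<rangle> \<in> W" for v j using that unfolding W_iff by auto
      have 3: "(\<exists>!j. \<langle>v, j\<rangle> \<in> {p \<in> W. p \<in> {p. \<langle>p, \<one>\<rangle> \<in> elts s}}) \<longleftrightarrow> 
        (\<exists>j. j \<prec> K \<and> ((\<langle>v, j\<rangle> \<in> W \<and>
            \<langle>\<langle>v, j\<rangle>, \<one>\<rangle> \<in> elts s) \<and>
        (\<forall>j'. j' \<prec> K \<longrightarrow>
            (\<langle>v, j'\<rangle> \<in> W \<and>
                \<langle>\<langle>v, j'\<rangle>, \<one>\<rangle> \<in> elts s \<longrightarrow> j' = j))))" for v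
        unfolding Ex1_def mem_Collect_eq using 2 by blast
      show ?thesis unfolding 3 using 1 by blast
    qed
    have B: "(\<forall>e i. e \<prec> l \<longrightarrow> i \<prec> l \<longrightarrow>
        \<langle>i, e\<rangle> \<in> f \<longrightarrow>
            (\<forall>v\<in>elts e. \<langle>v, K\<rangle> \<prec> l) \<longrightarrow>
        q e {p \<in> W. p \<in> {p. \<langle>p, \<one>\<rangle> \<in> elts s}}) \<longleftrightarrow> ?B s l" for s l
    proof -
      have "(\<forall>v\<in>elts e. \<langle>v, K\<rangle> \<prec> l) \<longleftrightarrow>
          (\<forall>v. v \<prec> e \<longrightarrow> (v \<in> elts e \<longrightarrow>
              \<langle>v, K\<rangle> \<prec> l))" for e
        using elts_less by blast
      then show ?thesis by (simp only: mem_Collect_eq) blast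
    qed
    show ?thesis unfolding T_def G_def A B
      using bin_seq_length_le unfolding less_succ by blast
  qed
  moreover have "definable 1 (\<lambda>a. \<exists>l. l \<prec> a 0 \<oplus> \<one> \<and>
      (bin_seq (a 0) l \<and> ?A (a 0) l \<and> ?B (a 0) l))"
    by (rule definable_intros definable_bin_seq definable_elts definable_q definable_mem | simp add: V W f)+
  from comprehension[of 1 "\<lambda>s. \<exists>l. l \<prec> s \<oplus> \<one> \<and> (bin_seq s l \<and>
      ?A s l \<and> ?B s l)", OF this]
  have "{s. \<exists>l. l \<prec> s \<oplus> \<one> \<and> (bin_seq s l \<and> ?A s l \<and> ?B s l)} \<in> Sets M" .
  ultimately have T: "T \<in> Sets M" by (rule back_subst[of "\<lambda>S. S \<in> Sets M", OF _ sym, rotated])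
  have "is_bin_tree T" unfolding is_bin_tree_def
  proof (intro conjI ballI allI impI)
    fix s t l' assume s: "s \<in> T" and t: "bin_seq t l' \<and> elts t \<subseteq> elts s"
    obtain l where l: "bin_seq s l" "G l {p. \<langle>p, \<one>\<rangle> \<in> elts s}" using s
      unfolding T_def by blast
    have "G l' {p. \<langle>p, \<one>\<rangle> \<in> elts t}"
    proof (rule G_mono[OF l(2)])
      show "l' \<preceq> l" using bin_seq_subset_length t l(1) by blast
      show "p \<in> {p. \<langle>p, \<one>\<rangle> \<in> elts s} \<longleftrightarrow>
          p \<in> {p. \<langle>p, \<one>\<rangle> \<in> elts t}" if "p \<prec> l'" for p
        using bin_seq_subset_agree[of t l' "elts s" p \<one>] bin_seq_unique[OF l(1)] t that by blast
    qed
    then show "t \<in> T" using t unfolding T_def by blast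
  qed (auto simp: T_def)
  moreover have ex: "\<exists>s\<in>T. bin_seq s l" for l
  proof -
    let ?V = "{v. v \<prec> l \<and> v \<in> V}"
    let ?P = "\<lambda>e. e \<prec> l \<and> (\<exists>i. i \<prec> l \<and>
        \<langle>i, e\<rangle> \<in> f) \<and> (\<forall>v. v \<prec> e \<longrightarrow>
            (v \<in> elts e \<longrightarrow> \<langle>v, K\<rangle> \<prec> l))"
    let ?E = "{e. ?P e}"
    have "definable 1 (\<lambda>a. a 0 \<prec> l \<and> a 0 \<in> V)"
      by (rule definable_intros definable_mem | simp add: V)+
    then have V': "?V \<in> Sets M" by (rule comprehension)
    have "definable 1 (\<lambda>a. ?P (a 0))" by (rule definable_intros definable_mem definable_elts | simp add: f)+
    then have E': "?E \<in> Sets M" by (rule comprehension)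
    have E_elts: "\<langle>v, K\<rangle> \<prec> l" "v \<prec> l" "v \<in> V" if "e \<in> ?E" "v \<in> elts e" for e v
    proof -
      show 1: "\<langle>v, K\<rangle> \<prec> l" using that elts_less by blast
      show "v \<prec> l" using fst_le_pr 1 by (rule ar.le_less_trans)
      show "v \<in> V" using that hyp unfolding is_hypergraph_def seq_range_def by blast
    qed
    have "finite_partial_hypergraph ?V ?E V (seq_range f)"
      unfolding finite_partial_hypergraph_def is_finite_def
    proof (intro conjI ballI)
      show "?V \<subseteq> V" "\<exists>k. \<forall>i\<in>?V. i \<prec> k" "\<exists>k. \<forall>i\<in>?E. i \<prec> k" by blast+
      show "?E \<subseteq> seq_range f" unfolding seq_range_def by blast
      show "elts e \<subseteq> ?V" if "e \<in> ?E" for e using E_elts(2,3)[OF that] by blast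
    qed
    then obtain \<chi> where \<chi>: "\<chi> \<in> Sets M" "is_coloring k ?V \<chi>" "Q ?E \<chi>"
      using fin V' E' unfolding finitely_colorable_def has_coloring_def by blast
    have sub: "\<chi> \<subseteq> W" using \<chi>(2)
      unfolding is_coloring_def is_function_def K_def[symmetric] subset_iff W_iff by blast
    then have W\<chi>: "{p \<in> W. p \<in> \<chi>} = \<chi>" by blast
    have G: "G l \<chi>" unfolding G_def W\<chi>
    proof (intro conjI ballI allI impI)
      fix v assume v: "v \<in> V" "\<langle>v, K\<rangle> \<prec> l"
      have "v \<prec> l" using fst_le_pr v(2) by (rule ar.le_less_trans)
      then show "\<exists>!j. \<langle>v, j\<rangle> \<in> \<chi>" using v(1) \<chi>(2)
        unfolding is_coloring_def is_function_def by blast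
    next
      fix e i assume "e \<prec> l" "i \<prec> l" "\<langle>i, e\<rangle> \<in> f" "\<forall>v\<in>elts e. \<langle>v, K\<rangle> \<prec> l"
      then have "e \<in> ?E" by blast
      then show "q e \<chi>" using \<chi>(3) unfolding Q by blast
    qed
    obtain s where s: "bin_seq s l" "\<forall>x. x \<prec> l \<longrightarrow>
        (\<langle>x, \<one>\<rangle> \<in> elts s \<longleftrightarrow> x \<in> \<chi>)"
      using ex_bin_seq[OF \<chi>(1)] by blast
    have "G l {p. \<langle>p, \<one>\<rangle> \<in> elts s}" by (rule G_mono[OF G ar.order_refl]) (use s(2) in simp)
    then show ?thesis using s(1) unfolding T_def by blast
  qed
  moreover have "\<not> is_finite T" unfolding is_finite_def
  proof
    assume "\<exists>b. \<forall>s\<in>T. s \<prec> b"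
    then obtain b where b: "\<forall>s\<in>T. s \<prec> b" by blast
    obtain s where "s \<in> T" "bin_seq s b" using ex by blast
    then show False using b bin_seq_length_le[of s b] ar.not_less by blast
  qed
  ultimately obtain g where g: "g \<in> Sets M" "is_path g T" using \<open>WKL\<close> T unfolding WKL_def by blast
  define B where "B = {p. \<langle>p, \<one>\<rangle> \<in> g}"
  have GB: "G l B" for l
  proof -
    obtain s where s: "s \<in> T" "bin_seq s l" "elts s \<subseteq> g" using g(2) unfolding is_path_def by blast
    obtain l' where "bin_seq s l'" "G l' {p. \<langle>p, \<one>\<rangle> \<in> elts s}" using s(1)
      unfolding T_def by blast
    then have "G l {p. \<langle>p, \<one>\<rangle> \<in> elts s}" using bin_seq_length_unique[OF s(2)] by blast
    then show ?thesis
    proof (rule G_mono[OF _ ar.order_refl])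
      fix p assume "p \<prec> l"
      moreover have "\<langle>p, y\<rangle> \<in> g \<Longrightarrow>
          \<langle>p, z\<rangle> \<in> g \<Longrightarrow> y = z" for y z
        using g(2) unfolding is_path_def is_function_def by blast
      ultimately have "\<langle>p, \<one>\<rangle> \<in> elts s \<longleftrightarrow>
          \<langle>p, \<one>\<rangle> \<in> g" by (rule bin_seq_subset_agree[OF s(2,3)])
      then show "p \<in> {p. \<langle>p, \<one>\<rangle> \<in> elts s} \<longleftrightarrow>
          p \<in> B" unfolding B_def by simp
    qed
  qed
  let ?\<chi> = "{p \<in> W. p \<in> B}"
  have "definable 1 (\<lambda>a. a 0 \<in> W \<and> \<langle>a 0, \<one>\<rangle> \<in> g)"
    by (rule definable_intros definable_mem | simp add: W g)+
  then have \<chi>: "?\<chi> \<in> Sets M" unfolding B_def mem_Collect_eq by (rule comprehension)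
  have "is_coloring k V ?\<chi>" unfolding is_coloring_def is_function_def K_def[symmetric]
  proof (intro conjI ballI)
    show "\<exists>x\<in>V. \<exists>y\<in>{j. j \<prec> K}. p = \<langle>x, y\<rangle>" if "p \<in> ?\<chi>" for p using that unfolding mem_Collect_eq W_iff by blast
    fix v assume v: "v \<in> V"
    have "\<langle>v, K\<rangle> \<prec> \<langle>v, K\<rangle> \<oplus> \<one>" by (simp add: less_succ)
    then show "\<exists>!j. \<langle>v, j\<rangle> \<in> ?\<chi>"
      using GB[of "\<langle>v, K\<rangle> \<oplus> \<one>"] v unfolding G_def by blast
  qed
  moreover have "Q (seq_range f) ?\<chi>" unfolding Q
  proof
    fix e assume "e \<in> seq_range f"
    then obtain i where i: "\<langle>i, e\<rangle> \<in> f" unfolding seq_range_def by blast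
    define l where "l = (\<langle>e, K\<rangle> \<oplus> i) \<oplus> \<one>"
    have l: "\<langle>e, K\<rangle> \<prec> l" "i \<prec> l" unfolding l_def less_succ by (rule le_add1 le_add2)+
    have "e \<prec> l" using fst_le_pr l(1) by (rule ar.le_less_trans)
    moreover have "\<langle>v, K\<rangle> \<prec> l" if "v \<in> elts e" for v
    proof (rule ar.le_less_trans[OF _ l(1)])
      show "\<langle>v, K\<rangle> \<preceq> \<langle>e, K\<rangle>"
        using elts_less[OF that] by (intro pr_mono) (auto intro: ar.less_imp_le)
    qed
    ultimately show "q e ?\<chi>" using GB[of l] l(2) i unfolding G_def by blast
  qed
  ultimately show ?thesis using \<chi> unfolding has_coloring_def by blast
qed

lemma num_less_iff: "x \<prec> num k \<longleftrightarrow> (\<exists>i<k. x = num i)"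
proof (induction k)
  case 0
  then show ?case using basic(7) by simp
next
  case (Suc k)
  then show ?case using less_Suc_eq by (auto simp: basic(8))
qed

lemma num_eq_iff [simp]: "num i = num j \<longleftrightarrow> i = j"
proof -
  have "num i \<prec> num j" if "i < j" for i j using that num_less_iff by blast
  then show ?thesis by (metis ar.less_irrefl nat_neq_iff)
qed

lemma edge_seq_imp_set:
  assumes "compactness_edge_seq Q k" "0 < k" and empty: "\<And>\<chi>. Q {} \<chi>"
  shows "compactness_edge_set Q k"
  unfolding compactness_edge_set_def
proof (intro ballI impI, elim conjE)
  fix V E assume V: "V \<in> Sets M" and E: "E \<in> Sets M" and h: "is_hypergraph V E" "finitely_colorable Q k V E"
  show "has_coloring Q k V E"
  proof (cases "E = {}")
    case True
    have "definable 1 (\<lambda>a. \<exists>v. v \<prec> a 0 \<oplus> \<one> \<and> (v \<in> V \<and>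
        a 0 = \<langle>v, \<zero>\<rangle>))" by (rule definable_intros definable_mem | simp add: V)+
    then have "{p. \<exists>v. v \<prec> p \<oplus> \<one> \<and> (v \<in> V \<and>
        p = \<langle>v, \<zero>\<rangle>)} \<in> Sets M" by (rule comprehension)
    moreover have "{p. \<exists>v. v \<prec> p \<oplus> \<one> \<and> (v \<in> V \<and>
        p = \<langle>v, \<zero>\<rangle>)} = {p. \<exists>v\<in>V. p = \<langle>v, \<zero>\<rangle>}"
      by (auto simp: less_succ fst_le_pr)
    moreover have "\<zero> \<prec> num k" using assms(2) num_less_iff[of \<zero> k] by (auto intro!: exI[of _ 0])
    then have "is_coloring k V {p. \<exists>v\<in>V. p = \<langle>v, \<zero>\<rangle>}"
      unfolding is_coloring_def is_function_def by auto
    ultimately show ?thesis using True empty unfolding has_coloring_def by auto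
  next
    case False
    then obtain d where d: "d \<in> E" by blast
    let ?P = "\<lambda>p. \<exists>i. i \<prec> p \<oplus> \<one> \<and> (i \<in> E \<and>
        p = \<langle>i, i\<rangle> \<or> i \<notin> E \<and> p = \<langle>i, d\<rangle>)"
    have "definable 1 (\<lambda>a. ?P (a 0))" by (rule definable_intros definable_mem | simp add: E)+
    then have F: "{p. ?P p} \<in> Sets M" by (rule comprehension)
    have F_iff: "\<langle>i, e\<rangle> \<in> {p. ?P p} \<longleftrightarrow>
        i \<in> E \<and> e = i \<or> i \<notin> E \<and> e = d" for i e
      unfolding mem_Collect_eq less_succ pr_eq_iff using fst_le_pr by blast
    have "is_function {p. ?P p} UNIV UNIV" unfolding is_function_def F_iff by blast
    moreover have "seq_range {p. ?P p} = E" unfolding seq_range_def F_iff using d by blast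
    ultimately show ?thesis using assms(1) V F h unfolding compactness_edge_seq_def by fastforce
  qed
qed

end

section \<open>Hypergraph attached to a binary tree\<close>

context l2_structure
begin

definition proper_edge :: "'m \<Rightarrow> 'm set \<Rightarrow> bool" where
  "proper_edge e \<chi> \<longleftrightarrow>
      ((\<exists>u\<in>elts e. \<exists>v\<in>elts e. u \<noteq> v) \<longrightarrow>
          \<not> (\<exists>j. \<forall>v\<in>elts e. \<langle>v, j\<rangle> \<in> \<chi>))"

definition conflict_free_edge :: "'m \<Rightarrow> 'm set \<Rightarrow> bool" where
  "conflict_free_edge e \<chi> \<longleftrightarrow>
      (\<exists>j. \<exists>!v. v \<in> elts e \<and> \<langle>v, j\<rangle> \<in> \<chi>)"

lemma proper_iff: "proper E \<chi> \<longleftrightarrow> (\<forall>e\<in>E. proper_edge e \<chi>)"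
  unfolding proper_def proper_edge_def ..

lemma conflict_free_iff: "conflict_free E \<chi> \<longleftrightarrow>
    (\<forall>e\<in>E. conflict_free_edge e \<chi>)"
  unfolding conflict_free_def conflict_free_edge_def ..

lemma proper_edge_local:
  "(\<And>v j. v \<in> elts e \<Longrightarrow> \<langle>v, j\<rangle> \<in> \<chi> \<longleftrightarrow>
      \<langle>v, j\<rangle> \<in> \<chi>') \<Longrightarrow> proper_edge e \<chi> \<Longrightarrow>
          proper_edge e \<chi>'"
  unfolding proper_edge_def by simp

lemma conflict_free_edge_local:
  "(\<And>v j. v \<in> elts e \<Longrightarrow> \<langle>v, j\<rangle> \<in> \<chi> \<longleftrightarrow>
      \<langle>v, j\<rangle> \<in> \<chi>') \<Longrightarrow> conflict_free_edge e \<chi> \<Longrightarrow>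
          conflict_free_edge e \<chi>'"
  unfolding conflict_free_edge_def by (simp cong: conj_cong)

text \<open>On edges with at most three vertices the two notions agree: both forbid exactly the constant colorings.\<close>

definition triple_condition :: "('m \<Rightarrow> 'm set \<Rightarrow> bool) \<Rightarrow> bool" where
  "triple_condition q \<longleftrightarrow> (\<forall>e a b c \<chi> col. elts e = {a, b, c} \<and>
     (\<forall>v\<in>{a, b, c}. \<forall>j. \<langle>v, j\<rangle> \<in> \<chi> \<longleftrightarrow>
         j = col v) \<and> a \<noteq> b \<longrightarrow>
     (q e \<chi> \<longleftrightarrow> \<not> (col a = col b \<and> col b = col c)))"

lemma triple_condition_proper: "triple_condition proper_edge"
  unfolding triple_condition_def
proof (intro allI impI, elim conjE)
  fix e a b c \<chi> and col :: "'m \<Rightarrow> 'm"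
  assume *: "elts e = {a, b, c}" "\<forall>v\<in>{a, b, c}. \<forall>j. \<langle>v, j\<rangle> \<in> \<chi> \<longleftrightarrow> j = col v" "a \<noteq> b"
  then show "proper_edge e \<chi> \<longleftrightarrow> \<not> (col a = col b \<and> col b = col c)"
    unfolding proper_edge_def by auto
qed

lemma triple_condition_conflict_free: "triple_condition conflict_free_edge"
  unfolding triple_condition_def
proof (intro allI impI, elim conjE)
  fix e a b c \<chi> and col :: "'m \<Rightarrow> 'm"
  assume *: "elts e = {a, b, c}" "\<forall>v\<in>{a, b, c}. \<forall>j. \<langle>v, j\<rangle> \<in> \<chi> \<longleftrightarrow> j = col v" and "a \<noteq> b"
  have "v \<in> {a, b, c} \<and> \<langle>v, j\<rangle> \<in> \<chi> \<longleftrightarrow>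
      v \<in> {a, b, c} \<and> j = col v" for v j using *(2) by blast
  then have "conflict_free_edge e \<chi> \<longleftrightarrow>
      (\<exists>j. \<exists>!v. v \<in> {a, b, c} \<and> j = col v)"
    unfolding conflict_free_edge_def *(1) by (simp only:)
  also have "\<dots> \<longleftrightarrow> \<not> (col a = col b \<and> col b = col c)"
  proof
    assume "\<exists>j. \<exists>!v. v \<in> {a, b, c} \<and> j = col v"
    then obtain j v where v: "v \<in> {a, b, c}" "j = col v" "\<And>w. w \<in> {a, b, c} \<Longrightarrow>
        j = col w \<Longrightarrow> w = v" by blast
    show "\<not> (col a = col b \<and> col b = col c)"
    proof
      assume "col a = col b \<and> col b = col c"
      then have j: "j = col a" "j = col b" using v(1,2) by auto
      have "a = v" by (rule v(3)[OF _ j(1)]) simp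
      moreover have "b = v" by (rule v(3)[OF _ j(2)]) simp
      ultimately show False using \<open>a \<noteq> b\<close> by simp
    qed
  next
    assume "\<not> (col a = col b \<and> col b = col c)"
    then consider "col a \<noteq> col b" "col a \<noteq> col c" | "col b \<noteq> col a" "col b \<noteq> col c" 
      | "col c \<noteq> col a" "col c \<noteq> col b" by metis
    then show "\<exists>j. \<exists>!v. v \<in> {a, b, c} \<and> j = col v"
    proof cases
      case 1
      then show ?thesis by (intro exI[of _ "col a"] ex1I[of _ a]) auto
    next
      case 2
      then show ?thesis by (intro exI[of _ "col b"] ex1I[of _ b]) auto
    next
      case 3
      then show ?thesis by (intro exI[of _ "col c"] ex1I[of _ c]) auto
    qed
  qed
  finally show "conflict_free_edge e \<chi> \<longleftrightarrow> \<not> (col a = col b \<and> col b = col c)" .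
qed

end

context rca0
begin

lemma position_bound: "\<langle>\<langle>v, j\<rangle>, y\<rangle> \<in> elts s \<Longrightarrow> j \<prec> s"
  using snd_le_pr[of j v] fst_le_pr[of "\<langle>v, j\<rangle>" y] elts_less by (meson ar.le_less_trans)

lemma definable_proper_edge:
  assumes "is_term f" "is_term g" "W \<in> Sets M"
  shows "definable n (\<lambda>a. proper_edge (f a) {p \<in> W. \<langle>p, \<one>\<rangle> \<in> elts (g a)})"
proof (rule definable_subst2[OF _ assms(1,2)])
  have "proper_edge e {p \<in> W. \<langle>p, \<one>\<rangle> \<in> elts s} \<longleftrightarrow>
    ((\<exists>u. u \<prec> e \<and> (\<exists>v. v \<prec> e \<and> (u \<in> elts e \<and>
        v \<in> elts e \<and> u \<noteq> v))) \<longrightarrow>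
     \<not> (\<exists>j. j \<prec> s \<and> (\<forall>v. v \<prec> e \<longrightarrow>
         (v \<in> elts e \<longrightarrow> \<langle>v, j\<rangle> \<in> W \<and>
             \<langle>\<langle>v, j\<rangle>, \<one>\<rangle> \<in> elts s))))" for e s
  proof -
    have "(\<exists>u. u \<prec> e \<and> (\<exists>v. v \<prec> e \<and> (u \<in> elts e \<and>
        v \<in> elts e \<and> u \<noteq> v))) \<longleftrightarrow>
      (\<exists>u\<in>elts e. \<exists>v\<in>elts e. u \<noteq> v)" using elts_less by blast
    moreover have "(\<exists>j. j \<prec> s \<and> (\<forall>v. v \<prec> e \<longrightarrow>
        (v \<in> elts e \<longrightarrow> \<langle>v, j\<rangle> \<in> W \<and>
            \<langle>\<langle>v, j\<rangle>, \<one>\<rangle> \<in> elts s))) \<longleftrightarrow>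
      (\<exists>j. \<forall>v\<in>elts e. \<langle>v, j\<rangle> \<in> {p \<in> W. \<langle>p, \<one>\<rangle> \<in> elts s})" if u: "u \<in> elts e" for u
    proof
      assume "\<exists>j. \<forall>v\<in>elts e. \<langle>v, j\<rangle> \<in> {p \<in> W. \<langle>p, \<one>\<rangle> \<in> elts s}"
      then obtain j where j: "\<forall>v\<in>elts e. \<langle>v, j\<rangle> \<in> {p \<in> W. \<langle>p, \<one>\<rangle> \<in> elts s}" by blast
      then have "j \<prec> s" using u position_bound by blast
      then show "\<exists>j. j \<prec> s \<and> (\<forall>v. v \<prec> e \<longrightarrow>
          (v \<in> elts e \<longrightarrow> \<langle>v, j\<rangle> \<in> W \<and>
              \<langle>\<langle>v, j\<rangle>, \<one>\<rangle> \<in> elts s))"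
        using j by blast
    qed (use elts_less in blast)
    ultimately show ?thesis unfolding proper_edge_def by blast
  qed
  then show "definable 3 (\<lambda>a. proper_edge (a (Suc 0)) {p \<in> W. \<langle>p, \<one>\<rangle> \<in> elts (a (Suc (Suc 0)))})"
    by (simp only:) (rule definable_intros definable_elts definable_mem | simp add: assms)+
qed

lemma definable_conflict_free_edge:
  assumes "is_term f" "is_term g" "W \<in> Sets M"
  shows "definable n (\<lambda>a. conflict_free_edge (f a) {p \<in> W. \<langle>p, \<one>\<rangle> \<in> elts (g a)})"
proof (rule definable_subst2[OF _ assms(1,2)])
  have "conflict_free_edge e {p \<in> W. \<langle>p, \<one>\<rangle> \<in> elts s} \<longleftrightarrow>
    (\<exists>j. j \<prec> s \<and> (\<exists>v. v \<prec> e \<and> ((v \<in> elts e \<and>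
        \<langle>v, j\<rangle> \<in> W \<and> \<langle>\<langle>v, j\<rangle>, \<one>\<rangle> \<in> elts s) \<and>
      (\<forall>w. w \<prec> e \<longrightarrow>
          (w \<in> elts e \<and> \<langle>w, j\<rangle> \<in> W \<and>
              \<langle>\<langle>w, j\<rangle>, \<one>\<rangle> \<in> elts s \<longrightarrow> w = v)))))" for e s
    unfolding conflict_free_edge_def Ex1_def mem_Collect_eq
    using elts_less position_bound by blast
  then show "definable 3 (\<lambda>a. conflict_free_edge (a (Suc 0)) {p \<in> W. \<langle>p, \<one>\<rangle> \<in> elts (a (Suc (Suc 0)))})"
    by (simp only:) (rule definable_intros definable_elts definable_mem | simp add: assms)+
qed

text \<open>Here $p_s$, $n_s$, $x_i$ and $c_j$ are the pairs of $s$, $s$, $i$, $j$ with $0$, $1$, $2$, $3$. An edge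
  with two vertices is listed with \<open>c = b\<close>. The quantifiers are bounded for the sake of definability.\<close>

definition gadget :: "'m set \<Rightarrow> 'm \<Rightarrow> 'm \<Rightarrow> 'm \<Rightarrow> 'm \<Rightarrow> bool" where
  "gadget T K a b c \<longleftrightarrow>
     (\<exists>s. s \<prec> a \<oplus> \<one> \<and> (a = \<langle>s, num 0\<rangle> \<and>
         b = \<langle>s, num 1\<rangle> \<and> c = b)) \<or>
     (\<exists>s. s \<prec> a \<oplus> \<one> \<and> (\<exists>t. t \<prec> b \<oplus> \<one> \<and>
         (\<exists>u. u \<prec> c \<oplus> \<one> \<and> (\<exists>l. l \<prec> s \<oplus> \<one> \<and>
       (a = \<langle>s, num 1\<rangle> \<and> b = \<langle>t, num 0\<rangle> \<and>
           c = \<langle>u, num 0\<rangle> \<and>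
        bin_seq s l \<and> bin_seq t (l \<oplus> \<one>) \<and> bin_seq u (l \<oplus> \<one>) \<and>
        (\<forall>p. p \<prec> s \<longrightarrow> (p \<in> elts s \<longrightarrow>
            p \<in> elts t \<and> p \<in> elts u)) \<and>
        \<langle>l, \<zero>\<rangle> \<in> elts t \<and> \<langle>l, \<one>\<rangle> \<in> elts u))))) \<or>
     (\<exists>s. s \<prec> a \<oplus> \<one> \<and> (a = \<langle>s, num 0\<rangle> \<and>
         b = \<langle>\<one>, num 3\<rangle> \<and> c = b \<and> s \<notin> T)) \<or>
     (\<exists>s. s \<prec> a \<oplus> \<one> \<and> (a = \<langle>s, num 0\<rangle> \<and>
         b = \<langle>\<zero>, num 3\<rangle> \<and> c = b \<and> bin_seq s \<zero>)) \<or>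
     (\<exists>t. t \<prec> b \<oplus> \<one> \<and> (\<exists>l. l \<prec> c \<oplus> \<one> \<and>
         (a = \<langle>\<one>, num 3\<rangle> \<and> b = \<langle>t, num 0\<rangle> \<and>
             c = \<langle>l, num 2\<rangle> \<and>
       bin_seq t (l \<oplus> \<one>) \<and> \<langle>l, \<zero>\<rangle> \<in> elts t))) \<or>
     (\<exists>t. t \<prec> b \<oplus> \<one> \<and> (\<exists>l. l \<prec> c \<oplus> \<one> \<and>
         (a = \<langle>\<zero>, num 3\<rangle> \<and> b = \<langle>t, num 1\<rangle> \<and>
             c = \<langle>l, num 2\<rangle> \<and>
       bin_seq t (l \<oplus> \<one>) \<and> \<langle>l, \<one>\<rangle> \<in> elts t))) \<or>
     (\<exists>i. i \<prec> K \<and> (\<exists>j. j \<prec> K \<and> (a = \<langle>i, num 3\<rangle> \<and>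
         b = \<langle>j, num 3\<rangle> \<and> c = b \<and> i \<noteq> j))) \<or>
     (\<exists>y. y \<prec> a \<oplus> \<one> \<and> (\<exists>x. x \<prec> num 3 \<and>
         (\<exists>j. j \<prec> K \<and>
       (a = \<langle>y, x\<rangle> \<and> b = \<langle>j, num 3\<rangle> \<and> c = b \<and>
           j \<noteq> \<zero> \<and> j \<noteq> \<one>))))"

lemma gadget_intros:
  "gadget T K \<langle>s, num 0\<rangle> \<langle>s, num 1\<rangle> \<langle>s, num 1\<rangle>"
  "bin_seq s l \<Longrightarrow> bin_seq t (l \<oplus> \<one>) \<Longrightarrow>
      bin_seq u (l \<oplus> \<one>) \<Longrightarrow> elts s \<subseteq> elts t \<Longrightarrow>
          elts s \<subseteq> elts u \<Longrightarrow>
     \<langle>l, \<zero>\<rangle> \<in> elts t \<Longrightarrow>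
         \<langle>l, \<one>\<rangle> \<in> elts u \<Longrightarrow>
             gadget T K \<langle>s, num 1\<rangle> \<langle>t, num 0\<rangle> \<langle>u, num 0\<rangle>"
  "s \<notin> T \<Longrightarrow> gadget T K \<langle>s, num 0\<rangle> \<langle>\<one>, num 3\<rangle> \<langle>\<one>, num 3\<rangle>"
  "bin_seq s \<zero> \<Longrightarrow> gadget T K \<langle>s, num 0\<rangle> \<langle>\<zero>, num 3\<rangle> \<langle>\<zero>, num 3\<rangle>"
  "bin_seq t (l \<oplus> \<one>) \<Longrightarrow> \<langle>l, \<zero>\<rangle> \<in> elts t \<Longrightarrow>
      gadget T K \<langle>\<one>, num 3\<rangle> \<langle>t, num 0\<rangle> \<langle>l, num 2\<rangle>"
  "bin_seq t (l \<oplus> \<one>) \<Longrightarrow> \<langle>l, \<one>\<rangle> \<in> elts t \<Longrightarrow>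
      gadget T K \<langle>\<zero>, num 3\<rangle> \<langle>t, num 1\<rangle> \<langle>l, num 2\<rangle>"
  "i \<prec> K \<Longrightarrow> j \<prec> K \<Longrightarrow> i \<noteq> j \<Longrightarrow>
      gadget T K \<langle>i, num 3\<rangle> \<langle>j, num 3\<rangle> \<langle>j, num 3\<rangle>"
  "x \<prec> num 3 \<Longrightarrow> j \<prec> K \<Longrightarrow> j \<noteq> \<zero> \<Longrightarrow>
      j \<noteq> \<one> \<Longrightarrow> gadget T K \<langle>y, x\<rangle> \<langle>j, num 3\<rangle> \<langle>j, num 3\<rangle>"
  unfolding gadget_def less_succ
  subgoal by (rule disjI1, rule exI[of _ s], rule conjI, rule fst_le_pr, simp)
  subgoal by (rule disjI2, rule disjI1, rule exI[of _ s], rule conjI, rule fst_le_pr, rule exI[of _ t],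
      rule conjI, rule fst_le_pr, rule exI[of _ u], rule conjI, rule fst_le_pr, rule exI[of _ l],
      rule conjI, erule bin_seq_length_le, blast)
  subgoal by (rule disjI2, rule disjI2, rule disjI1, rule exI[of _ s], rule conjI, rule fst_le_pr, simp)
  subgoal by (rule disjI2, rule disjI2, rule disjI2, rule disjI1, rule exI[of _ s], rule conjI,
      rule fst_le_pr, simp)
  subgoal by (rule disjI2, rule disjI2, rule disjI2, rule disjI2, rule disjI1, rule exI[of _ t],
      rule conjI, rule fst_le_pr, rule exI[of _ l], rule conjI, rule fst_le_pr, simp)
  subgoal by (rule disjI2, rule disjI2, rule disjI2, rule disjI2, rule disjI2, rule disjI1,
      rule exI[of _ t], rule conjI, rule fst_le_pr, rule exI[of _ l], rule conjI, rule fst_le_pr,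
      simp)
  subgoal by (rule disjI2, rule disjI2, rule disjI2, rule disjI2, rule disjI2, rule disjI2, rule disjI1,
      rule exI[of _ i], rule conjI, assumption, rule exI[of _ j], rule conjI, assumption, simp)
  subgoal by (rule disjI2, rule disjI2, rule disjI2, rule disjI2, rule disjI2, rule disjI2, rule disjI2,
      rule exI[of _ y], rule conjI, rule fst_le_pr, rule exI[of _ x], rule conjI, assumption,
      rule exI[of _ j], rule conjI, assumption, simp)
  done

lemma gadget_cases:
  assumes "gadget T K a b c"
  obtains
    (neg) s where "a = \<langle>s, num 0\<rangle>" "b = \<langle>s, num 1\<rangle>" "c = b"
  | (split) s t u l where "a = \<langle>s, num 1\<rangle>" "b = \<langle>t, num 0\<rangle>" "c = \<langle>u, num 0\<rangle>" "bin_seq s l"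
      "bin_seq t (l \<oplus> \<one>)" "bin_seq u (l \<oplus> \<one>)" "elts s \<subseteq> elts t" "elts s \<subseteq> elts u"
      "\<langle>l, \<zero>\<rangle> \<in> elts t" "\<langle>l, \<one>\<rangle> \<in> elts u"
  | (tree) s where "a = \<langle>s, num 0\<rangle>" "b = \<langle>\<one>, num 3\<rangle>" "c = b" "s \<notin> T"
  | (root) s where "a = \<langle>s, num 0\<rangle>" "b = \<langle>\<zero>, num 3\<rangle>" "c = b" "bin_seq s \<zero>"
  | (bit0) t l where "a = \<langle>\<one>, num 3\<rangle>" "b = \<langle>t, num 0\<rangle>" "c = \<langle>l, num 2\<rangle>"
      "bin_seq t (l \<oplus> \<one>)" "\<langle>l, \<zero>\<rangle> \<in> elts t"
  | (bit1) t l where "a = \<langle>\<zero>, num 3\<rangle>" "b = \<langle>t, num 1\<rangle>" "c = \<langle>l, num 2\<rangle>"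
      "bin_seq t (l \<oplus> \<one>)" "\<langle>l, \<one>\<rangle> \<in> elts t"
  | (clique) i j where "i \<prec> K" "j \<prec> K" "a = \<langle>i, num 3\<rangle>" "b = \<langle>j, num 3\<rangle>" "c = b" "i \<noteq> j"
  | (palette) y x j where "x \<prec> num 3" "j \<prec> K" "a = \<langle>y, x\<rangle>" "b = \<langle>j, num 3\<rangle>" "c = b"
      "j \<noteq> \<zero>" "j \<noteq> \<one>"
  using assms unfolding gadget_def
  apply (elim disjE exE conjE)
         apply (rule neg; assumption)
  subgoal premises prems for s t u l
  proof (rule split[of s t u l])
    show "elts s \<subseteq> elts t" "elts s \<subseteq> elts u" using prems(19) elts_less[of _ s] by blast+
  qed (rule prems)+
       apply (rule tree; assumption)
      apply (rule root; assumption)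
     apply (rule bit0; assumption)
    apply (rule bit1; assumption)
   apply (rule clique; assumption)
  apply (rule palette; assumption)
  done

lemma num_3: "x \<prec> num 3 \<longleftrightarrow> x = num 0 \<or> x = num 1 \<or> x = num 2"
  unfolding num_less_iff numeral_3_eq_3 numeral_2_eq_2 by (auto simp: less_Suc_eq simp del: num.simps)

lemma gadget_neq: "gadget T K a b c \<Longrightarrow> a \<noteq> b"
  by (erule gadget_cases) (auto simp: num_3 simp del: num.simps)

lemma definable_gadget:
  assumes "T \<in> Sets M" "is_term f" "is_term g" "is_term h"
  shows "definable n (\<lambda>a. gadget T K (f a) (g a) (h a))"
proof (rule definable_subst3[OF _ assms(2-4)])
  show "definable (Suc (Suc (Suc (Suc 0)))) (\<lambda>a. gadget T K (a (Suc 0)) (a (Suc (Suc 0))) (a (Suc (Suc (Suc 0)))))"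
    unfolding gadget_def
    by (rule definable_intros definable_elts definable_bin_seq definable_mem assms | simp only: fun_upd_apply nat.inject nat.distinct if_False simp_thms)+
qed

definition gadget_edges :: "'m set \<Rightarrow> 'm \<Rightarrow> 'm set" where
  "gadget_edges T K = {e. is_code e \<and> (\<exists>a b c. elts e = {a, b, c} \<and> gadget T K a b c)}"

lemma elts_eq_triple_bounded: "elts e = {a, b, c} \<longleftrightarrow>
    a \<prec> e \<and> b \<prec> e \<and> c \<prec> e \<and>
  (\<forall>x. x \<prec> e \<longrightarrow> (x \<in> elts e \<longleftrightarrow>
      x = a \<or> x = b \<or> x = c))" (is "?L \<longleftrightarrow> ?R")
proof
  assume e: ?L
  then have "a \<in> elts e" "b \<in> elts e" "c \<in> elts e" by auto
  then show ?R using elts_less e by auto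
next
  assume *: ?R
  show ?L
  proof (intro set_eqI iffI)
    show "x \<in> {a, b, c}" if "x \<in> elts e" for x using elts_less[OF that] that * by blast
    show "x \<in> elts e" if "x \<in> {a, b, c}" for x using that * by blast
  qed
qed

lemma gadget_edges_in_Sets:
  assumes T: "T \<in> Sets M"
  shows "gadget_edges T K \<in> Sets M"
proof -
  define S where "S e a b c \<longleftrightarrow>
      (\<forall>x. x \<prec> e \<longrightarrow> (x \<in> elts e \<longleftrightarrow>
          x = a \<or> x = b \<or> x = c))" for e a b c
  define P where "P e \<longleftrightarrow> is_code e \<and> (\<exists>a. a \<prec> e \<and>
      (\<exists>b. b \<prec> e \<and> (\<exists>c. c \<prec> e \<and> (S e a b c \<and> gadget T K a b c))))" for e
  have "definable 1 (\<lambda>a. P (a 0))"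
    unfolding P_def S_def by (rule definable_intros definable_elts definable_is_code definable_gadget | simp add: T)+
  then have "{e. P e} \<in> Sets M" by (rule comprehension)
  moreover have "gadget_edges T K = {e. P e}"
    unfolding gadget_edges_def elts_eq_triple_bounded S_def[symmetric] P_def by blast
  ultimately show ?thesis by simp
qed

lemma ex_code_triple: "\<exists>e. is_code e \<and> elts e = {a, b, c}"
proof -
  have "definable 1 (\<lambda>x. x 0 = a \<or> x 0 = b \<or> x 0 = c)" by (rule definable_intros)+
  then have S: "{x. x = a \<or> x = b \<or> x = c} \<in> Sets M" by (rule comprehension)
  have "x \<prec> (a \<oplus> (b \<oplus> c)) \<oplus> \<one>" if "x \<in> {x. x = a \<or> x = b \<or> x = c}" for x
    using that le_add1[of a "b \<oplus> c"] ar.order_trans[OF le_add1[of b c] le_add2[of "b \<oplus> c" a]]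
      ar.order_trans[OF le_add2[of c b] le_add2[of "b \<oplus> c" a]] unfolding less_succ by blast
  from ex_code[OF S this] obtain e where "is_code e" "elts e = {x. x = a \<or> x = b \<or> x = c}" by blast
  moreover have "{x. x = a \<or> x = b \<or> x = c} = {a, b, c}" by blast
  ultimately show ?thesis by auto
qed

lemma long_branches:
  assumes T: "is_bin_tree T" "\<not> is_finite T"
  shows "\<exists>s\<in>T. \<exists>l. bin_seq s l \<and> b \<preceq> l"
proof -
  obtain B where B: "\<And>c. is_code c \<Longrightarrow>
      (\<forall>i\<in>elts c. i \<prec> \<langle>b, \<one>\<rangle> \<oplus> \<one>) \<Longrightarrow> c \<preceq> B"
    using codes_bounded by blast
  obtain s where s: "s \<in> T" "\<not> s \<prec> B \<oplus> \<one>" using T(2) unfolding is_finite_def by blast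
  obtain l where l: "bin_seq s l" using T(1) s(1) unfolding is_bin_tree_def by blast
  have "b \<preceq> l"
  proof (rule ccontr)
    assume "\<not> b \<preceq> l"
    then have lb: "l \<prec> b" by (simp add: ar.not_le)
    have "i \<prec> \<langle>b, \<one>\<rangle> \<oplus> \<one>" if i: "i \<in> elts s" for i
    proof -
      obtain x y where x: "i = \<langle>x, y\<rangle>" "x \<prec> l" "y = \<zero> \<or> y = \<one>"
        using bin_seq_is_pair[OF l i] by blast
      have "x \<preceq> b" using x(2) lb by (meson ar.less_trans ar.less_imp_le)
      moreover have "y \<preceq> \<one>" using x(3) zero_le by auto
      ultimately show ?thesis unfolding x(1) less_succ by (rule pr_mono)
    qed
    then have "s \<preceq> B" using B l unfolding bin_seq_def by blast
    then show False using s(2) unfolding less_succ by blast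
  qed
  then show ?thesis using s(1) l by blast
qed

end

lemma ex1_iff_the: "\<exists>!j. R j \<Longrightarrow> R j \<longleftrightarrow> j = (THE j. R j)"
  using theI'[of R] by blast

context rca0
begin

lemma zero_one_less_num:
  assumes "2 \<le> k"
  shows "\<zero> \<prec> num k" "\<one> \<prec> num k"
proof -
  have "num 0 \<prec> num k" unfolding num_less_iff by (rule exI[of _ 0]) (use assms in simp)
  moreover have "num 1 \<prec> num k" unfolding num_less_iff by (rule exI[of _ 1]) (use assms in simp)
  ultimately show "\<zero> \<prec> num k" "\<one> \<prec> num k" by simp_all
qed

lemma clique_uses_all_colors:
  assumes "\<And>i. i \<prec> num k \<Longrightarrow>
      c i \<prec> num k" "\<And>i j. i \<prec> num k \<Longrightarrow> j \<prec> num k \<Longrightarrow>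
          i \<noteq> j \<Longrightarrow> c i \<noteq> c j" "x \<prec> num k"
  shows "\<exists>j. j \<prec> num k \<and> x = c j"
proof -
  have eq: "{i. i \<prec> num k} = num ` {..<k}" by (auto simp: num_less_iff)
  have "c ` {i. i \<prec> num k} = {i. i \<prec> num k}"
  proof (rule endo_inj_surj)
    show "finite {i. i \<prec> num k}" unfolding eq by simp
    show "c ` {i. i \<prec> num k} \<subseteq> {i. i \<prec> num k}" using assms(1) by blast
    show "inj_on c {i. i \<prec> num k}" using assms(2) by (intro inj_onI) blast
  qed
  then show ?thesis using assms(3) by blast
qed

lemma coloring_imp_path:
  assumes k: "2 \<le> k" and T: "T \<in> Sets M" and q: "triple_condition q"
    and \<chi>: "\<chi> \<in> Sets M" "is_coloring k UNIV \<chi>"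
      and good: "\<forall>e\<in>gadget_edges T (num k). q e \<chi>"
  shows "\<exists>g\<in>Sets M. is_path g T"
proof -
  define K where "K = num k"
  define col where "col v = (THE j. \<langle>v, j\<rangle> \<in> \<chi>)" for v
  have col: "\<langle>v, j\<rangle> \<in> \<chi> \<longleftrightarrow> j = col v" for v j
  proof -
    have "\<exists>!j. \<langle>v, j\<rangle> \<in> \<chi>" using \<chi>(2)
      unfolding is_coloring_def is_function_def by blast
    then show ?thesis unfolding col_def by (rule ex1_iff_the)
  qed
  have col_less: "col v \<prec> K" for v
  proof -
    have "\<langle>v, col v\<rangle> \<in> \<chi>" using col by blast
    then have "\<exists>x\<in>UNIV. \<exists>y\<in>{j. j \<prec> K}. \<langle>v, col v\<rangle> = \<langle>x, y\<rangle>"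
      using \<chi>(2) unfolding is_coloring_def is_function_def K_def by blast
    then show ?thesis by auto
  qed
  have edge: "\<not> (col a = col b \<and> col b = col c)" if g: "gadget T K a b c" for a b c
  proof -
    obtain e where e: "is_code e" "elts e = {a, b, c}" using ex_code_triple by blast
    then have "e \<in> gadget_edges T K" using g unfolding gadget_edges_def by blast
    then have "q e \<chi>" using good unfolding K_def by blast
    moreover have "q e \<chi> \<longleftrightarrow> \<not> (col a = col b \<and> col b = col c)"
      using q[unfolded triple_condition_def, rule_format, of e a b c \<chi> col] e(2) col gadget_neq[OF g] by simp
    ultimately show ?thesis by simp
  qed
  define F where "F = col \<langle>\<zero>, num 3\<rangle>"
  define C where "C = col \<langle>\<one>, num 3\<rangle>"
  have two: "col \<langle>y, x\<rangle> = F \<or> col \<langle>y, x\<rangle> = C" if x: "x \<prec> num 3" for x y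
  proof -
    have "\<exists>j. j \<prec> num k \<and> col \<langle>y, x\<rangle> = col \<langle>j, num 3\<rangle>"
    proof (rule clique_uses_all_colors)
      show "col \<langle>i, num 3\<rangle> \<prec> num k" for i using col_less unfolding K_def .
      show "col \<langle>y, x\<rangle> \<prec> num k" using col_less unfolding K_def .
      show "col \<langle>i, num 3\<rangle> \<noteq> col \<langle>j, num 3\<rangle>" if "i \<prec> num k" "j \<prec> num k" "i \<noteq> j" for i j
        using edge[OF gadget_intros(7)[of i K j T]] that[folded K_def] by blast
    qed
    then obtain j where j: "j \<prec> K" "col \<langle>y, x\<rangle> = col \<langle>j, num 3\<rangle>" unfolding K_def by blast
    from this(2) have "j = \<zero> \<or> j = \<one>" using edge[OF gadget_intros(8)[OF x j(1), of T y]] by blast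
    then show ?thesis using j(2) unfolding F_def C_def by blast
  qed
  note two' = two[unfolded num_3]
  have FC: "F \<noteq> C"
  proof -
    have "\<zero> \<prec> K" "\<one> \<prec> K" unfolding K_def by (rule zero_one_less_num[OF k])+
    then show ?thesis using edge[OF gadget_intros(7)[of \<zero> K \<one>]] unfolding F_def C_def by auto
  qed
  define true where "true v \<longleftrightarrow> col v = C" for v
  have neg: "true \<langle>s, num 1\<rangle> \<longleftrightarrow> \<not> true \<langle>s, num 0\<rangle>" for s
    using edge[OF gadget_intros(1)[of T K s]] two'[of "num 0" s] two'[of "num 1" s] FC unfolding true_def by auto
  have split: "true \<langle>t, num 0\<rangle> \<or>
      true \<langle>u, num 0\<rangle>" if g: "gadget T K \<langle>s, num 1\<rangle> \<langle>t, num 0\<rangle> \<langle>u, num 0\<rangle>" and s: "true \<langle>s, num 0\<rangle>" for s t u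
    using edge[OF g] neg[of s] s two'[of "num 1" s] two'[of "num 0" t] two'[of "num 0" u] unfolding true_def by auto
  have tree: "s \<in> T" if s: "true \<langle>s, num 0\<rangle>" for s
  proof (rule ccontr)
    assume "s \<notin> T"
    from edge[OF gadget_intros(3)[OF this]] show False using s unfolding true_def C_def by blast
  qed
  have root: "true \<langle>s, num 0\<rangle>" if s: "bin_seq s \<zero>" for s
    using edge[OF gadget_intros(4)[OF s]] two'[of "num 0" s] unfolding true_def F_def by auto
  have bit0: "\<not> true \<langle>l, num 2\<rangle>" if t: "bin_seq t (l \<oplus> \<one>)" "\<langle>l, \<zero>\<rangle> \<in> elts t" "true \<langle>t, num 0\<rangle>" for t l
    using edge[OF gadget_intros(5)[OF t(1,2)]] t(3) unfolding true_def C_def by auto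
  have bit1: "true \<langle>l, num 2\<rangle>" if t: "bin_seq t (l \<oplus> \<one>)" "\<langle>l, \<one>\<rangle> \<in> elts t" "true \<langle>t, num 0\<rangle>" for t l
    using edge[OF gadget_intros(6)[OF t(1,2)]] t(3) neg[of t] two'[of "num 1" t] two'[of "num 2" l]
    unfolding true_def F_def by auto
  have true_iff: "true v \<longleftrightarrow> \<langle>v, C\<rangle> \<in> \<chi>" for v
    unfolding true_def col by auto
  define g where "g = {p. \<exists>i. i \<prec> p \<oplus> \<one> \<and>
      (true \<langle>i, num 2\<rangle> \<and> p = \<langle>i, \<one>\<rangle> \<or>
          \<not> true \<langle>i, num 2\<rangle> \<and> p = \<langle>i, \<zero>\<rangle>)}"
  have "definable 1 (\<lambda>a. \<exists>i. i \<prec> a 0 \<oplus> \<one> \<and>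
      (true \<langle>i, num 2\<rangle> \<and> a 0 = \<langle>i, \<one>\<rangle> \<or>
          \<not> true \<langle>i, num 2\<rangle> \<and> a 0 = \<langle>i, \<zero>\<rangle>))"
    unfolding true_iff by (rule definable_intros definable_mem \<chi>(1) | simp)+
  then have g: "g \<in> Sets M" unfolding g_def by (rule comprehension)
  have g_iff: "\<langle>i, y\<rangle> \<in> g \<longleftrightarrow>
      true \<langle>i, num 2\<rangle> \<and> y = \<one> \<or>
          \<not> true \<langle>i, num 2\<rangle> \<and> y = \<zero>" for i y
    unfolding g_def mem_Collect_eq less_succ pr_eq_iff using fst_le_pr by blast
  have fun_g: "is_function g UNIV {\<zero>, \<one>}" unfolding is_function_def
  proof (intro conjI ballI)
    show "\<exists>x\<in>UNIV. \<exists>y\<in>{\<zero>, \<one>}. p = \<langle>x, y\<rangle>" if "p \<in> g" for p using that unfolding g_def by blast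
    show "\<exists>!y. \<langle>x, y\<rangle> \<in> g" for x
      unfolding g_iff by (cases "true \<langle>x, num 2\<rangle>") auto
  qed
  have "\<exists>s. bin_seq s l \<and> elts s \<subseteq> g \<and> true \<langle>s, num 0\<rangle>" for l
  proof (rule Sigma1_induct[where x=l])
    show "definable 2 (\<lambda>a. bin_seq (a 1) (a 0) \<and> elts (a 1) \<subseteq> g \<and>
        true \<langle>a 1, num 0\<rangle>)" unfolding true_iff
      by (rule definable_intros definable_bin_seq definable_elts_subset definable_mem g \<chi>(1))+
    obtain e where "bin_seq e \<zero>" using ex_bin_seq[OF g] by blast
    moreover from this have "elts e = {}" using bin_seq_is_pair[of e \<zero>] basic(7) by blast
    ultimately show "\<exists>s. bin_seq s \<zero> \<and> elts s \<subseteq> g \<and>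
        true \<langle>s, num 0\<rangle>" using root by blast
    fix l s assume s: "bin_seq s l \<and> elts s \<subseteq> g \<and> true \<langle>s, num 0\<rangle>"
    obtain t where t: "bin_seq t (l \<oplus> \<one>)" "elts t = insert \<langle>l, \<zero>\<rangle> (elts s)" using ex_bin_seq_append s by blast
    obtain u where u: "bin_seq u (l \<oplus> \<one>)" "elts u = insert \<langle>l, \<one>\<rangle> (elts s)" using ex_bin_seq_append s by blast
    have "gadget T K \<langle>s, num 1\<rangle> \<langle>t, num 0\<rangle> \<langle>u, num 0\<rangle>"
      by (rule gadget_intros(2)[of s l]) (use s t u in blast)+
    then consider "true \<langle>t, num 0\<rangle>" | "true \<langle>u, num 0\<rangle>" using split s by blast
    then show "\<exists>s. bin_seq s (l \<oplus> \<one>) \<and> elts s \<subseteq> g \<and>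
        true \<langle>s, num 0\<rangle>"
    proof cases
      case 1
      then have "\<langle>l, \<zero>\<rangle> \<in> g" using bit0[OF t(1)] t(2) unfolding g_iff by blast
      then show ?thesis using 1 t s by (intro exI[of _ t]) simp
    next
      case 2
      then have "\<langle>l, \<one>\<rangle> \<in> g" using bit1[OF u(1)] u(2) unfolding g_iff by blast
      then show ?thesis using 2 u s by (intro exI[of _ u]) simp
    qed
  qed
  then have "is_path g T" using fun_g tree unfolding is_path_def by blast
  then show ?thesis using g by blast
qed

lemma gadget_finitely_colorable:
  assumes k: "2 \<le> k" and T: "T \<in> Sets M" "is_bin_tree T" "\<not> is_finite T" and q: "triple_condition q"
    and Q: "\<And>E \<chi>. Q E \<chi> \<longleftrightarrow> (\<forall>e\<in>E. q e \<chi>)"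
  shows "finitely_colorable Q k UNIV (gadget_edges T (num k))"
  unfolding finitely_colorable_def
proof (intro ballI impI)
  fix V E assume V: "V \<in> Sets M" and "E \<in> Sets M"
    and H: "finite_partial_hypergraph V E UNIV (gadget_edges T (num k))"
  define K where "K = num k"
  have K: "\<zero> \<prec> K" "\<one> \<prec> K" unfolding K_def by (rule zero_one_less_num[OF k])+
  obtain b where b: "\<forall>e\<in>E. e \<prec> b" using H
    unfolding finite_partial_hypergraph_def is_finite_def by blast
  obtain s L where s: "s \<in> T" "bin_seq s L" "b \<preceq> L" using long_branches[OF T(2,3)] by blast
  define on where "on y \<longleftrightarrow>
      (\<exists>l. l \<prec> y \<oplus> \<one> \<and> bin_seq y l) \<and>
          (\<forall>p. p \<prec> y \<longrightarrow> (p \<in> elts y \<longrightarrow> p \<in> elts s))" for y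
  have on_iff: "on y \<longleftrightarrow> (\<exists>l. bin_seq y l) \<and> elts y \<subseteq> elts s" for y
    unfolding on_def less_succ using elts_less[of _ y] bin_seq_length_le[of y] by blast
  let ?ONE = "\<lambda>v. \<exists>y. y \<prec> v \<oplus> \<one> \<and> (v = \<langle>y, num 0\<rangle> \<and>
      on y \<or> v = \<langle>y, num 1\<rangle> \<and> \<not> on y \<or>
          v = \<langle>y, num 2\<rangle> \<and> \<langle>y, \<one>\<rangle> \<in> elts s)"
  define ONE where "ONE = {v. ?ONE v}"
  have "definable 1 (\<lambda>a. ?ONE (a 0))"
    unfolding on_def by (rule definable_intros definable_elts definable_bin_seq | simp)+
  then have ONE: "ONE \<in> Sets M" unfolding ONE_def by (rule comprehension)
  have ONE_iff: "\<langle>y, x\<rangle> \<in> ONE \<longleftrightarrow>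
      x = num 0 \<and> on y \<or> x = num 1 \<and> \<not> on y \<or>
          x = num 2 \<and> \<langle>y, \<one>\<rangle> \<in> elts s" for x y
    unfolding ONE_def mem_Collect_eq less_succ pr_eq_iff using fst_le_pr by blast
  define R where "R v j \<longleftrightarrow>
      (v \<in> ONE \<and> j = \<one>) \<or>
          (v \<notin> ONE \<and> (\<exists>i. i \<prec> K \<and> (v = \<langle>i, num 3\<rangle> \<and> j = i))) \<or>
    (v \<notin> ONE \<and> \<not> (\<exists>i. i \<prec> K \<and> v = \<langle>i, num 3\<rangle>) \<and>
        j = \<zero>)" for v j
  have R_fun: "\<exists>!j. R v j" for v
  proof (cases "v \<in> ONE")
    case True
    then show ?thesis unfolding R_def by simp
  next
    case False
    show ?thesis
    proof (cases "\<exists>i. i \<prec> K \<and> v = \<langle>i, num 3\<rangle>")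
      case True
      then obtain i where i: "i \<prec> K" "v = \<langle>i, num 3\<rangle>" by blast
      then have "R v j \<longleftrightarrow> j = i" for j using False unfolding R_def by auto
      then show ?thesis by simp
    next
      case False
      then have "R v j \<longleftrightarrow> j = \<zero>" for j using \<open>v \<notin> ONE\<close>
        unfolding R_def by auto
      then show ?thesis by simp
    qed
  qed
  have R_less: "R v j \<Longrightarrow> j \<prec> K" for v j using K unfolding R_def by auto
  define col where "col v = (THE j. R v j)" for v
  have col: "R v j \<longleftrightarrow> j = col v" for v j
    unfolding col_def by (rule ex1_iff_the[OF R_fun])
  define \<chi> where "\<chi> = {p. \<exists>v. v \<prec> p \<oplus> \<one> \<and>
      (\<exists>j. j \<prec> p \<oplus> \<one> \<and> (p = \<langle>v, j\<rangle> \<and> v \<in> V \<and> R v j))}"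
  have "definable 1 (\<lambda>a. \<exists>v. v \<prec> a 0 \<oplus> \<one> \<and>
      (\<exists>j. j \<prec> a 0 \<oplus> \<one> \<and> (a 0 = \<langle>v, j\<rangle> \<and> v \<in> V \<and>
          R v j)))"
    unfolding R_def by (rule definable_intros definable_mem V ONE | simp)+
  then have \<chi>: "\<chi> \<in> Sets M" unfolding \<chi>_def by (rule comprehension)
  have \<chi>_iff: "\<langle>v, j\<rangle> \<in> \<chi> \<longleftrightarrow> v \<in> V \<and> R v j" for v j
    unfolding \<chi>_def mem_Collect_eq less_succ pr_eq_iff using fst_le_pr snd_le_pr by blast
  have "is_coloring k V \<chi>" unfolding is_coloring_def is_function_def K_def[symmetric]
  proof (intro conjI ballI)
    show "\<exists>x\<in>V. \<exists>y\<in>{j. j \<prec> K}. p = \<langle>x, y\<rangle>" if "p \<in> \<chi>" for p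
      using that R_less unfolding \<chi>_def by blast
    show "\<exists>!y. \<langle>v, y\<rangle> \<in> \<chi>" if "v \<in> V" for v
      unfolding \<chi>_iff using R_fun that by simp
  qed
  moreover have "q e \<chi>" if e: "e \<in> E" for e
  proof -
    obtain a b' c where g: "elts e = {a, b', c}" "gadget T K a b' c"
      using e H unfolding finite_partial_hypergraph_def gadget_edges_def K_def by blast
    have sub: "{a, b', c} \<subseteq> V" using e H g(1) unfolding finite_partial_hypergraph_def by blast
    have low: "v \<prec> L" if "v \<in> elts e" for v
      using elts_less[OF that] b e s(3) ar.less_trans ar.less_le_trans by blast
    have cP: "col \<langle>y, num 0\<rangle> = (if on y then \<one> else \<zero>)" for y
    proof -
      have "R \<langle>y, num 0\<rangle> (if on y then \<one> else \<zero>)"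
        unfolding R_def ONE_iff by (simp del: num.simps)
      then show ?thesis unfolding col by simp
    qed
    have cN: "col \<langle>y, num 1\<rangle> = (if on y then \<zero> else \<one>)" for y
    proof -
      have "R \<langle>y, num 1\<rangle> (if on y then \<zero> else \<one>)"
        unfolding R_def ONE_iff by (simp del: num.simps)
      then show ?thesis unfolding col by simp
    qed
    have cX: "col \<langle>y, num 2\<rangle> = (if \<langle>y, \<one>\<rangle> \<in> elts s then \<one> else \<zero>)" for y
    proof -
      have "R \<langle>y, num 2\<rangle> (if \<langle>y, \<one>\<rangle> \<in> elts s then \<one> else \<zero>)" unfolding R_def ONE_iff by (simp del: num.simps)
      then show ?thesis unfolding col by simp
    qed
    have cC: "col \<langle>i, num 3\<rangle> = i" if "i \<prec> K" for i
    proof -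
      have "R \<langle>i, num 3\<rangle> i" unfolding R_def ONE_iff using that by (simp del: num.simps)
      then show ?thesis unfolding col by simp
    qed
    have unique: "\<langle>l, \<zero>\<rangle> \<notin> elts s \<or>
        \<langle>l, \<one>\<rangle> \<notin> elts s" for l
      using bin_seq_unique[OF s(2), of l \<zero> \<one>] ar.zero_neq_one by blast
    from g(2) have "\<not> (col a = col b' \<and> col b' = col c)"
    proof (cases rule: gadget_cases)
      case (neg y)
      then show ?thesis unfolding neg cP cN using ar.zero_neq_one by auto
    next
      case (split y t u l)
      show ?thesis
      proof (cases "on y")
        case True
        have "y \<prec> L" using low[of a] fst_le_pr[of y "num 1"] unfolding split(1)[symmetric] g(1)
          by (auto intro: ar.le_less_trans)
        then have "l \<prec> L" using bin_seq_length_le[OF split(4)] by (meson ar.le_less_trans)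
        then obtain z where z: "z = \<zero> \<or> z = \<one>" "\<langle>l, z\<rangle> \<in> elts s"
          by (rule bin_seq_total[OF s(2)])
        have et: "elts t = insert \<langle>l, \<zero>\<rangle> (elts y)"
          by (rule bin_seq_append_elts) (use split in blast)+
        have eu: "elts u = insert \<langle>l, \<one>\<rangle> (elts y)"
          by (rule bin_seq_append_elts) (use split in blast)+
        have "on t \<or> on u" using True z split(5,6) unfolding on_iff et eu by blast
        then show ?thesis unfolding split(1-3) cP cN using True ar.zero_neq_one by auto
      next
        case False
        then have "\<not> on t" using split unfolding on_iff by blast
        then show ?thesis unfolding split(1-3) cP cN using False ar.zero_neq_one by auto
      qed
    next
      case (tree y)
      have "\<not> on y" using tree(4) s(1) T(2) unfolding on_iff is_bin_tree_def by blast
      then show ?thesis unfolding tree(1-3) cP cC[OF K(2)] by auto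
    next
      case (root y)
      have "elts y = {}" using bin_seq_is_pair[OF root(4)] basic(7) by blast
      then have "on y" using root(4) unfolding on_iff by blast
      then show ?thesis unfolding root(1-3) cP cC[OF K(1)] by auto
    next
      case (bit0 t l)
      have "\<not> (on t \<and> \<langle>l, \<one>\<rangle> \<in> elts s)" using bit0(5) unique
        unfolding on_iff by blast
      then show ?thesis unfolding bit0(1-3) cP cX cC[OF K(2)] by auto
    next
      case (bit1 t l)
      have "on t \<longrightarrow> \<langle>l, \<one>\<rangle> \<in> elts s" using bit1(5) unfolding on_iff by blast
      then show ?thesis unfolding bit1(1-3) cN cX cC[OF K(1)] by auto
    next
      case (clique i j)
      then show ?thesis using cC by auto
    next
      case (palette y x j)
      then have "col a = \<zero> \<or> col a = \<one>"
        unfolding num_3 using cP[of y] cN[of y] cX[of y] by (auto split: if_splits)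
      then show ?thesis using palette cC[OF palette(2)] by auto
    qed
    moreover have "\<forall>v\<in>{a, b', c}. \<forall>j. \<langle>v, j\<rangle> \<in> \<chi> \<longleftrightarrow> j = col v" using sub \<chi>_iff col by blast
    ultimately show "q e \<chi>"
      using q[unfolded triple_condition_def, rule_format, of e a b' c \<chi> col] g(1) gadget_neq[OF g(2)] by blast
  qed
  ultimately show "has_coloring Q k V E" using \<chi> unfolding has_coloring_def Q by blast
qed

lemma edge_set_imp_WKL:
  assumes k: "2 \<le> k" and c: "compactness_edge_set Q k" and q: "triple_condition q"
    and Q: "\<And>E \<chi>. Q E \<chi> \<longleftrightarrow> (\<forall>e\<in>E. q e \<chi>)"
  shows WKL
  unfolding WKL_def
proof (intro ballI impI, elim conjE)
  fix T assume T: "T \<in> Sets M" "is_bin_tree T" "\<not> is_finite T"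
  have "UNIV \<in> Sets M" using comprehension[of 0 "\<lambda>x. True", OF definable_const] by simp
  moreover have "is_hypergraph UNIV (gadget_edges T (num k))"
    unfolding is_hypergraph_def gadget_edges_def by blast
  ultimately have "has_coloring Q k UNIV (gadget_edges T (num k))"
    using c gadget_edges_in_Sets[OF T(1)] gadget_finitely_colorable[OF k T q Q]
    unfolding compactness_edge_set_def by blast
  then show "\<exists>f\<in>Sets M. is_path f T"
    using coloring_imp_path[OF k T(1) q] unfolding has_coloring_def Q by blast
qed

lemma compactness_iff_WKL:
  assumes k: "2 \<le> k" and q: "triple_condition q"
    and Q: "\<And>E \<chi>. Q E \<chi> \<longleftrightarrow> (\<forall>e\<in>E. q e \<chi>)"
    and local: "\<And>e \<chi> \<chi>'. (\<And>v j. v \<in> elts e \<Longrightarrow>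
        \<langle>v, j\<rangle> \<in> \<chi> \<longleftrightarrow>
            \<langle>v, j\<rangle> \<in> \<chi>') \<Longrightarrow> q e \<chi> \<Longrightarrow> q e \<chi>'"
    and definable_q: "\<And>n f g W. is_term f \<Longrightarrow> is_term g \<Longrightarrow>
        W \<in> Sets M \<Longrightarrow>
      definable n (\<lambda>a. q (f a) {p \<in> W. \<langle>p, \<one>\<rangle> \<in> elts (g a)})"
  shows "WKL0 \<longleftrightarrow> compactness_edge_seq Q k" "WKL0 \<longleftrightarrow> compactness_edge_set Q k"
proof -
  have "compactness_edge_seq Q k" if WKL
    unfolding compactness_edge_seq_def
  proof (intro ballI impI, elim conjE)
    fix V f assume H: "V \<in> Sets M" "f \<in> Sets M" "is_hypergraph V (seq_range f)"
      "finitely_colorable Q k V (seq_range f)"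
    show "has_coloring Q k V (seq_range f)"
      by (rule WKL_imp_coloring[of V f Q k q]) (fact that H Q local definable_q)+
  qed
  moreover have "compactness_edge_set Q k" if "compactness_edge_seq Q k"
    by (rule edge_seq_imp_set[OF that]) (use k Q in auto)
  moreover have WKL if "compactness_edge_set Q k"
    by (rule edge_set_imp_WKL[OF k that q Q])
  ultimately show "WKL0 \<longleftrightarrow> compactness_edge_seq Q k" "WKL0 \<longleftrightarrow>
      compactness_edge_set Q k"
    using RCA0 unfolding WKL0_def by blast+
qed

end

theorem theorem8:
  fixes k :: nat and M :: "'m l2_struct"
  assumes "k \<ge> 2"
    and "l2_structure.RCA0 M"
  shows "(l2_structure.WKL0 M \<longleftrightarrow>
            l2_structure.compactness_edge_seq M (l2_structure.proper M) k) \<and>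
         (l2_structure.WKL0 M \<longleftrightarrow>
            l2_structure.compactness_edge_seq M (l2_structure.conflict_free M) k) \<and>
         (l2_structure.WKL0 M \<longleftrightarrow>
            l2_structure.compactness_edge_set M (l2_structure.proper M) k) \<and>
         (l2_structure.WKL0 M \<longleftrightarrow>
            l2_structure.compactness_edge_set M (l2_structure.conflict_free M) k)"
proof -
  interpret rca0 M by unfold_locales (rule assms)
  have "WKL0 \<longleftrightarrow> compactness_edge_seq proper k" "WKL0 \<longleftrightarrow>
      compactness_edge_set proper k"
    by (rule compactness_iff_WKL[of k proper_edge];
      fact assms(1) triple_condition_proper proper_iff proper_edge_local definable_proper_edge)+
  moreover have "WKL0 \<longleftrightarrow> compactness_edge_seq conflict_free k" "WKL0 \<longleftrightarrow>
      compactness_edge_set conflict_free k"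
    by (rule compactness_iff_WKL[of k conflict_free_edge];
      fact assms(1) triple_condition_conflict_free conflict_free_iff conflict_free_edge_local definable_conflict_free_edge)+
  ultimately show ?thesis by blast
qed

end
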